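(* There exist absolute constants $C>0$ and $N_0$ such that for every prime power $q$ and every integer $n\ge 2$ with $q^n\ge N_0$, and every integer $1\le k\le n$ such that $r:=\frac{k-1}{\log n}\le \frac32$, one has $$\left|\frac{\mathbb{P}(\Omega(f_n)=k)}{\mathbb{P}(K(\pi_n)=k)}-h_q(r)\right|\le\frac{Ck}{q(\log n)^2}.$$
   Context: For a prime power $q$, $\mathbb{F}_q$ is the field with $q$ elements, $f_n=f_{n,q}$ is a uniformly random monic polynomial of degree $n$ in $\mathbb{F}_q[T]$, and $\Omega(f)$ is the number of monic irreducible factors of $f$ counted with multiplicity. $\pi_n$ is a uniformly random permutation in the symmetric group $S_n$, and $K(\pi)$ is the number of cycles of $\pi$ (fixed points included). Let $\mathcal{P}=\mathcal{P}_q$ be the set of monic irreducible polynomials over $\mathbb{F}_q$ and $|P|=q^{\deg P}$. For real $0\le x<q$ define $$h_q(x)=\prod_{P\in\mathcal{P}}\left(1-\frac{x}{|P|}\right)^{-1}\left(1-\frac{1}{|P|}\right)^{x}.$$ *)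

theory Defs
  imports
    "HOL-Probability.Probability"
    "HOL-Algebra.Polynomial_Divisibility"
    "HOL-Combinatorics.Orbits"
    "HOL-Number_Theory.Prime_Powers"
begin

text \<open>
  A finite field is a \<open>nat ring\<close> \<open>F\<close> with \<open>field F\<close> and finite carrier, rather than a type of class
  \<open>field\<close>, so that bounds uniform in \<open>F\<close> and in \<open>q = card (carrier F)\<close> can be stated.
  Natural numbers as elements lose no generality: every finite field is isomorphic to such an \<open>F\<close>.
  Elements of \<open>poly_ring F\<close> are coefficient lists with the leading coefficient first, the zero
  polynomial being the empty list.
\<close>

definition monic_polys :: "nat ring \<Rightarrow> nat \<Rightarrow> nat list set" where
  "monic_polys F n =
     {f \<in> carrier (poly_ring F).
        f \<noteq> [] \<and> Polynomials.lead_coeff f = \<one>\<^bsub>F\<^esub> \<and> Polynomials.degree f = n}"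

definition monic_irreducibles :: "nat ring \<Rightarrow> nat list set" where
  "monic_irreducibles F =
     {P \<in> (\<Union>d. monic_polys F d). pirreducible\<^bsub>F\<^esub> (carrier F) P}"

definition factor_multiplicity :: "nat ring \<Rightarrow> nat list \<Rightarrow> nat list \<Rightarrow> nat" where
  "factor_multiplicity F P f =
     (GREATEST m. (P [^]\<^bsub>poly_ring F\<^esub> m) pdivides\<^bsub>F\<^esub> f)"

definition Omega :: "nat ring \<Rightarrow> nat list \<Rightarrow> nat" where
  "Omega F f =
     (\<Sum>P \<in> {P \<in> monic_irreducibles F. P pdivides\<^bsub>F\<^esub> f}. factor_multiplicity F P f)"

definition random_monic :: "nat ring \<Rightarrow> nat \<Rightarrow> nat list pmf" where
  "random_monic F n = pmf_of_set (monic_polys F n)"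

definition random_perm :: "nat \<Rightarrow> (nat \<Rightarrow> nat) pmf" where
  "random_perm n = pmf_of_set {p. p permutes {1..n}}"

text \<open>The cycles of a permutation are its orbits; the orbit of a fixed point is a singleton.\<close>

definition num_cycles :: "nat \<Rightarrow> (nat \<Rightarrow> nat) \<Rightarrow> nat" where
  "num_cycles n p = card (orbit p ` {1..n})"

definition poly_norm :: "nat ring \<Rightarrow> nat list \<Rightarrow> real" where
  "poly_norm F P = real (card (carrier F)) ^ Polynomials.degree P"

text \<open>
  The infinite product is unordered: it is the limit of the products over finite subsets of the
  index set, the multiplicative analogue of \<open>infsum\<close>. It is only meaningful for
  \<open>0 \<le> x < card (carrier F)\<close>, where each factor is \<open>1 + O(1 / |P|^2)\<close>.
\<close>

definition h :: "nat ring \<Rightarrow> real \<Rightarrow> real" where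
  "h F x =
     Lim (finite_subsets_at_top (monic_irreducibles F))
       (\<lambda>S. \<Prod>P\<in>S. inverse (1 - x / poly_norm F P) * (1 - 1 / poly_norm F P) powr x)"

end

theory Submission
  imports Defs "HOL-Combinatorics.Stirling" "HOL-Real_Asymp.Real_Asymp"
begin

text \<open>
  Let \<open>q\<close> be the size of the field. Grouping the prime powers \<open>P\<^sup>j\<close> dividing a monic polynomial gives
  the recurrence satisfied by the coefficients of an Euler product, so that the generating polynomial
  of \<open>\<Omega>\<close> in degree \<open>n\<close>, divided by \<open>q ^ n\<close>, is the convolution of the generating polynomials of the
  number of cycles with the coefficients of
  \<open>H(u, x) = exp (\<Sum>m. u ^ m * a\<^sub>m(x) / m)\<close>, where
  \<open>a\<^sub>m(x) = q ^ (- m) * (\<Sum>P, j with j * deg P = m. deg P * (x ^ j - x))\<close>.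
  In the norm \<open>\<Sum>j. \<bar>c\<^sub>j\<bar> (9/5) ^ j\<close> the coefficients of \<open>H\<close> are \<open>O(1/q)\<close> with a geometric
  decay that is uniform in \<open>q\<close>, and \<open>H(1, x) = h(x)\<close>.

  It remains to compare \<open>P(K(\<pi>\<^sub>n\<^sub>-\<^sub>m) = k - j) / P(K(\<pi>\<^sub>n) = k)\<close> with \<open>r ^ j\<close>. Up to the factor \<open>1 / n\<close>, the probability
  \<open>P(K(\<pi>\<^sub>n) = k)\<close> is the elementary symmetric polynomial \<open>e\<^bsub>k-1\<^esub>\<close> of \<open>1, 1/2, \<dots>, 1/(n - 1)\<close>, and
  \<open>p\<^sub>1 e\<^sub>k - p\<^sub>2 e\<^bsub>k-1\<^esub> \<le> (k + 1) e\<^bsub>k+1\<^esub> \<le> p\<^sub>1 e\<^sub>k\<close>, where \<open>p\<^sub>1, p\<^sub>2\<close> are power sums, determines the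
  quotients of consecutive \<open>e\<^sub>k\<close> up to a relative error \<open>O(1 / ln n)\<close>. For bounded \<open>n\<close> only the factor
  \<open>1/q\<close> matters.
\<close>

subsection \<open>Elementary symmetric polynomials of reciprocals\<close>

text \<open>The elementary symmetric polynomial e_k of 1, 1/2, ..., 1/N; the last equation sorts the
  monomials by whether they contain the variable 1 / (N + 1).\<close>

fun harm_esym :: "nat \<Rightarrow> nat \<Rightarrow> real" where
  "harm_esym 0 0 = 1"
| "harm_esym 0 (Suc k) = 0"
| "harm_esym (Suc N) 0 = 1"
| "harm_esym (Suc N) (Suc k) = harm_esym N (Suc k) + harm_esym N k / real (Suc N)"

lemma harm_esym_0 [simp]: "harm_esym N 0 = 1"
  by (cases N) auto

lemma harm_esym_nonneg [simp]: "harm_esym N k \<ge> 0"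
  by (induction N k rule: harm_esym.induct) auto

text \<open>In the expansion of p_1 e_k every squarefree monomial of degree k + 1 occurs k + 1
  times, and the remaining monomials are nonnegative. In the induction on N a new variable x leaves
  the slack x^2 e_(k-1).\<close>

lemma harm_esym_upper: "real (Suc k) * harm_esym N (Suc k) \<le> harm N * harm_esym N k"
proof (induction N arbitrary: k)
  case 0
  then show ?case by (simp add: harm_def)
next
  case (Suc N)
  define x where "x = inverse (real (Suc N))"
  have x: "x \<ge> 0" "harm (Suc N) = harm N + x" by (auto simp: x_def harm_Suc)
  have es: "harm_esym (Suc N) (Suc i) = harm_esym N (Suc i) + x * harm_esym N i" for i
    by (simp add: x_def field_simps)
  show ?case
  proof (cases k)
    case 0
    then show ?thesis using Suc.IH[of 0] es[of 0] x by simp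
  next
    case (Suc i)
    have "x * (real (Suc i) * harm_esym N (Suc i)) \<le> x * (harm N * harm_esym N i)"
      by (intro mult_left_mono Suc.IH x)
    moreover have "0 \<le> x * x * harm_esym N i" by (simp add: x)
    moreover note Suc.IH[of "Suc i"]
    ultimately show ?thesis
      unfolding Suc es x by (simp add: algebra_simps)
  qed
qed

definition harm2 :: "nat \<Rightarrow> real" where
  "harm2 N = (\<Sum>i=1..N. inverse (real i) ^ 2)"

lemma harm2_le_2: "harm2 N \<le> 2"
proof -
  have "harm2 (Suc N) \<le> 2 - 1 / real (Suc N)" for N
  proof (induction N)
    case (Suc N)
    have "harm2 (Suc (Suc N)) = harm2 (Suc N) + inverse (real (Suc (Suc N))) ^ 2"
      by (simp add: harm2_def)
    also have "inverse (real (Suc (Suc N))) ^ 2 \<le> inverse (real (Suc N) * real (Suc (Suc N)))"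
      unfolding power2_eq_square inverse_mult_distrib[symmetric]
      by (intro le_imp_inverse_le mult_right_mono) auto
    also have "\<dots> = 1 / real (Suc N) - 1 / real (Suc (Suc N))"
      by (simp add: divide_simps)
    finally show ?case using Suc by simp
  qed (simp add: harm2_def)
  moreover have "2 - 1 / real (Suc M) \<le> 2" for M by simp
  ultimately have "harm2 (Suc M) \<le> 2" for M using order.trans by blast
  then show ?thesis by (cases N) (auto simp: harm2_def)
qed

lemma harm_esym_1: "harm_esym N (Suc 0) = harm N"
  by (induction N) (auto simp: harm_def field_simps)

text \<open>Newton's identity cut off after two terms. The monomials of p_1 e_(k+1) that contain a
  square are x_i^2 times a squarefree monomial of degree k without x_i; admitting x_i in the second
  factor enlarges their sum to p_2 e_k.\<close>

lemma harm_esym_lower_aux: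
  "real (Suc (Suc k)) * harm_esym N (Suc (Suc k))
     \<ge> harm N * harm_esym N (Suc k) - harm2 N * harm_esym N k"
proof (induction N arbitrary: k)
  case 0
  then show ?case by (simp add: harm_def harm2_def)
next
  case (Suc N)
  define x where "x = inverse (real (Suc N))"
  have x: "x \<ge> 0" "harm (Suc N) = harm N + x" "harm2 (Suc N) = harm2 N + x\<^sup>2"
    by (auto simp: x_def harm_Suc harm2_def)
  have es: "harm_esym (Suc N) (Suc i) = harm_esym N (Suc i) + x * harm_esym N i" for i
    by (simp add: x_def field_simps)
  show ?case
  proof (cases k)
    case 0
    then show ?thesis using Suc.IH[of 0]
      unfolding 0 es[of 0] es[of "Suc 0"] x by (simp add: harm_esym_1 algebra_simps power2_eq_square)
  next
    case (Suc i)
    have "x * (real (Suc (Suc i)) * harm_esym N (Suc (Suc i)))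
      \<ge> x * (harm N * harm_esym N (Suc i) - harm2 N * harm_esym N i)"
      by (intro mult_left_mono Suc.IH x)
    moreover have "0 \<le> x * x * x * harm_esym N i" by (simp add: x)
    moreover note Suc.IH[of "Suc i"]
    ultimately show ?thesis
      unfolding Suc es x by (simp add: algebra_simps power2_eq_square)
  qed
qed

lemma harm_esym_lower:
  "real (Suc (Suc k)) * harm_esym N (Suc (Suc k))
     \<ge> harm N * harm_esym N (Suc k) - 2 * harm_esym N k"
  using harm_esym_lower_aux[of N k] mult_right_mono[OF harm2_le_2, of "harm_esym N k" N]
  by simp

lemma harm_esym_mono: "N \<le> M \<Longrightarrow> harm_esym N k \<le> harm_esym M k"
  by (rule lift_Suc_mono_le[of "\<lambda>N. harm_esym N k"], cases k) auto

text \<open>Each added variable is at most 1 / (M + 1), so each of the i steps of the recursion adds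
  at most e_k / (M + 1).\<close>

lemma harm_esym_diff:
  "harm_esym (M + i) (Suc k) - harm_esym M (Suc k) \<le> real i / real (Suc M) * harm_esym (M + i) k"
proof (induction i)
  case (Suc i)
  have "harm_esym (M + Suc i) (Suc k) - harm_esym M (Suc k)
    = (harm_esym (M + i) (Suc k) - harm_esym M (Suc k)) + harm_esym (M + i) k / real (Suc (M + i))"
    by simp
  also have "\<dots> \<le> real i / real (Suc M) * harm_esym (M + i) k + harm_esym (M + i) k / real (Suc M)"
    using Suc.IH by (intro add_mono divide_left_mono) auto
  also have "\<dots> = real (Suc i) / real (Suc M) * harm_esym (M + i) k"
    by (simp add: add_divide_distrib distrib_right)
  also have "\<dots> \<le> real (Suc i) / real (Suc M) * harm_esym (M + Suc i) k"
    by (intro mult_left_mono harm_esym_mono) auto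
  finally show ?case .
qed auto

text \<open>Both sides are the coefficient of x^(k+1) in x (x + 1) ... (x + N) = N! x (1 + x) (1 +
  x/2) ... (1 + x/N); the proof matches the two recursions.\<close>

lemma stirling_eq_harm_esym: "real (stirling (Suc N) (Suc k)) = fact N * harm_esym N k"
proof (induction N arbitrary: k)
  case 0
  show ?case by (cases k) auto
next
  case (Suc N)
  show ?case
  proof (cases k)
    case 0
    then show ?thesis by (simp add: stirling_Suc_n_1 algebra_simps del: stirling.simps(4))
  next
    case (Suc i)
    have "fact (Suc N) * harm_esym (Suc N) (Suc i)
      = real (Suc N) * (fact N * harm_esym N (Suc i)) + fact N * harm_esym N i"
      by (simp add: distrib_left mult_ac del: of_nat_Suc)
    then show ?thesis
      unfolding \<open>k = Suc i\<close> stirling.simps(4)[of "Suc N"] Suc.IH[symmetric]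
      by (simp add: distrib_right del: stirling.simps)
  qed
qed

lemma harm_bounds:
  assumes "N \<ge> 1"
  shows "ln (real (Suc N)) \<le> harm N" "harm N \<le> ln (real (Suc N)) + 1"
proof -
  show "ln (real (Suc N)) \<le> harm N" using ln_le_harm[of N] by (simp add: add.commute)
  obtain M where N: "N = Suc M" using assms by (cases N) auto
  have "harm N \<le> ln (real N) + 1"
    using decseqD[OF decseq_harm_diff_ln, of 0 M] by (simp add: N harm_expand(2))
  also have "ln (real N) \<le> ln (real (Suc N))" using assms by simp
  finally show "harm N \<le> ln (real (Suc N)) + 1" by simp
qed

text \<open>By induction the previous ratio is at most 2, so the correction 2 e_i in
  \<open>harm_esym_lower\<close> is at most 4 e_(i+1). This leaves (L - 4) e_(i+1) <= (i + 2)
  e_(i+2).\<close>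

lemma harm_esym_ratio_upper:
  fixes N :: nat
  defines "L \<equiv> ln (real (Suc N))"
  assumes "L \<ge> 64" "real (Suc i) \<le> 3 / 2 * L"
  shows "harm_esym N (Suc i) > 0 \<and> harm_esym N i \<le> real (Suc i) / (L - 4) * harm_esym N (Suc i)"
  using assms(3)
proof (induction i)
  have N: "N \<ge> 1" using assms by (cases N) auto
  note hb = harm_bounds[OF N, folded L_def]
  {
    case 0
    have "harm N > (0::real)" using N by simp
    then show ?case using hb assms(2) N by (simp add: harm_esym_1 field_simps)
  next
    case (Suc i)
    have IH: "harm_esym N (Suc i) > 0" "harm_esym N i \<le> real (Suc i) / (L - 4) * harm_esym N (Suc i)"
      using Suc by auto
    have "real (Suc i) / (L - 4) \<le> 2" using Suc.prems assms(2) by (simp add: field_simps)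
    with IH have 1: "harm_esym N i \<le> 2 * harm_esym N (Suc i)"
      by (meson mult_right_mono order.trans harm_esym_nonneg)
    have "(L - 4) * harm_esym N (Suc i) \<le> harm N * harm_esym N (Suc i) - 4 * harm_esym N (Suc i)"
      using mult_right_mono[OF hb(1), of "harm_esym N (Suc i)"] by (simp add: left_diff_distrib)
    also have "\<dots> \<le> real (Suc (Suc i)) * harm_esym N (Suc (Suc i))"
      using harm_esym_lower[of N i] 1 by linarith
    finally have *: "(L - 4) * harm_esym N (Suc i) \<le> real (Suc (Suc i)) * harm_esym N (Suc (Suc i))" .
    moreover have "(L - 4) * harm_esym N (Suc i) > 0" using IH assms(2) by simp
    ultimately have "harm_esym N (Suc (Suc i)) > 0"
      by (smt (verit) zero_less_mult_iff of_nat_0_le_iff)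
    with * assms(2) show ?case by (simp add: field_simps)
  }
qed

text \<open>The ratio lies between (i + 1) / (L + 1) and (i + 1) / (L - 4), and for L >= 64 both
  ends differ from (i + 1) / L by at most 5 (i + 1) / L^2.\<close>

lemma harm_esym_ratio_bounds:
  fixes N :: nat
  defines "L \<equiv> ln (real (Suc N))"
  assumes L: "L \<ge> 64" and i: "real (Suc i) \<le> 3 / 2 * L"
  defines "\<rho> \<equiv> harm_esym N i / harm_esym N (Suc i)"
  shows "0 \<le> \<rho>" "\<rho> \<le> 8 / 5" "\<bar>\<rho> - real (Suc i) / L\<bar> \<le> 5 * real (Suc i) / L\<^sup>2"
proof -
  have N: "N \<ge> 1" using L L_def by (cases N) auto
  note hb = harm_bounds[OF N, folded L_def]
  note * = harm_esym_ratio_upper[OF L[unfolded L_def] i[unfolded L_def], folded L_def]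
  show "0 \<le> \<rho>" by (simp add: \<rho>_def)
  have upper: "\<rho> \<le> real (Suc i) / (L - 4)" using * by (simp add: \<rho>_def field_simps)
  \<comment> \<open>With i + 1 <= 3 L / 2 the quotient is at most 8/5 once L >= 64; this fixes the
    threshold 64.\<close>
  also have "\<dots> \<le> 8 / 5" using L i by (simp add: field_simps)
  finally show "\<rho> \<le> 8 / 5" .
  have h1: "harm N > (0::real)" using N by simp
  have "real (Suc i) / (L + 1) \<le> real (Suc i) / harm N"
    using hb L h1 by (intro divide_left_mono) auto
  also have "\<dots> \<le> \<rho>"
    using harm_esym_upper[of i N] * h1 by (simp add: \<rho>_def field_simps)
  finally have lower: "real (Suc i) / (L + 1) \<le> \<rho>" .
  have "1 / (L - 4) \<le> 1 / L + 5 / L\<^sup>2"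
    using L by (simp add: divide_simps power2_eq_square) (simp add: algebra_simps)
  hence "real (Suc i) * (1 / (L - 4)) \<le> real (Suc i) * (1 / L + 5 / L\<^sup>2)"
    by (intro mult_left_mono) auto
  hence u: "\<rho> - real (Suc i) / L \<le> 5 * real (Suc i) / L\<^sup>2"
    using upper by (simp add: algebra_simps add_divide_distrib)
  have "1 / L - 5 / L\<^sup>2 \<le> 1 / (L + 1)"
    using L by (simp add: divide_simps power2_eq_square) (simp add: algebra_simps)
  hence "real (Suc i) * (1 / L - 5 / L\<^sup>2) \<le> real (Suc i) * (1 / (L + 1))"
    by (intro mult_left_mono) auto
  hence l: "real (Suc i) / L - \<rho> \<le> 5 * real (Suc i) / L\<^sup>2"
    using lower by (simp add: algebra_simps add_divide_distrib)
  from u l show "\<bar>\<rho> - real (Suc i) / L\<bar> \<le> 5 * real (Suc i) / L\<^sup>2" by linarith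
qed

text \<open>The quotient e_(k-j) / e_k, where e vanishes at negative indices; truncated subtraction
  alone would give e_0 for j > k.\<close>

definition esym_quot :: "nat \<Rightarrow> nat \<Rightarrow> nat \<Rightarrow> real" where
  "esym_quot N k j = (if j \<le> k then harm_esym N (k - j) / harm_esym N k else 0)"

lemma harm_esym_pos:
  fixes N :: nat
  defines "L \<equiv> ln (real (Suc N))"
  assumes L: "L \<ge> 64" and k: "real k \<le> 3 / 2 * L"
  shows "harm_esym N k > 0"
  using harm_esym_ratio_upper[of N "k - 1"] assms by (cases k) auto

text \<open>The quotient is a product of j ratios of consecutive e_i, the ratio with index l being
  close to (k - l) / L = r - l / L. Replacing the ratios by r one at a time accumulates an error of
  order j^2 r / L, and the bound 8/5 on each ratio gives the exponential factor.\<close>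

lemma esym_quot_estimate:
  fixes N k :: nat
  defines "L \<equiv> ln (real (Suc N))"
  assumes L: "L \<ge> 64" and k: "real k \<le> 3 / 2 * L"
  defines "r \<equiv> real k / L"
  shows "0 \<le> esym_quot N k j" "esym_quot N k j \<le> (8/5) ^ j"
    and "\<bar>esym_quot N k j - r ^ j\<bar> \<le> 20 * real j ^ 2 * (r / L) * (8/5) ^ j"
proof -
  have r: "0 \<le> r" "r \<le> 3/2" using L k by (auto simp: r_def field_simps)
  have rat: "0 \<le> harm_esym N i / harm_esym N (Suc i)"
     "harm_esym N i / harm_esym N (Suc i) \<le> 8/5"
     "\<bar>harm_esym N i / harm_esym N (Suc i) - real (Suc i) / L\<bar> \<le> 5 * real (Suc i) / L\<^sup>2"
    if "Suc i \<le> k" for i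
  proof -
    have "real (Suc i) \<le> 3 / 2 * ln (real (Suc N))" using that k L_def by linarith
    from harm_esym_ratio_bounds[OF L[unfolded L_def] this, folded L_def]
    show "0 \<le> harm_esym N i / harm_esym N (Suc i)"
     "harm_esym N i / harm_esym N (Suc i) \<le> 8/5"
     "\<bar>harm_esym N i / harm_esym N (Suc i) - real (Suc i) / L\<bar> \<le> 5 * real (Suc i) / L\<^sup>2" .
  qed
  \<comment> \<open>The value 0 from j = k on makes the recursion \<open>T_Suc\<close> hold for all
    j.\<close>
  define \<rho> where "\<rho> j = (if j < k then harm_esym N (k - Suc j) / harm_esym N (k - j) else 0)" for j
  have pos: "harm_esym N i > 0" if "i \<le> k" for i
    using that k L_def by (intro harm_esym_pos[OF L[unfolded L_def]]) linarith
  have T_Suc: "esym_quot N k (Suc j) = \<rho> j * esym_quot N k j" for j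
    using pos[of "k - j"] by (auto simp: esym_quot_def \<rho>_def)
  have T_0: "esym_quot N k 0 = 1" using pos[of k] by (simp add: esym_quot_def)
  have \<rho>: "0 \<le> \<rho> j" "\<rho> j \<le> 8/5" for j
    using rat(1,2)[of "k - Suc j"] by (auto simp: \<rho>_def Suc_diff_Suc)
  show nn: "0 \<le> esym_quot N k j" for j
    by (induction j) (auto simp: T_0 T_Suc \<rho>)
  show T_le: "esym_quot N k j \<le> (8/5) ^ j" for j
  proof (induction j)
    case (Suc j)
    have "\<rho> j * esym_quot N k j \<le> 8/5 * (8/5) ^ j"
      using Suc by (intro mult_mono \<rho> nn) auto
    then show ?case by (simp add: T_Suc)
  qed (simp add: T_0)
  have r_L: "r / L \<ge> 0" using r L by simp
  have \<rho>_close: "\<bar>\<rho> j - r\<bar> \<le> 5 * (r / L) + real j / L" if "j \<le> k" for j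
  proof (cases "j < k")
    case True
    have "\<bar>\<rho> j - real (k - j) / L\<bar> \<le> 5 * real (k - j) / L\<^sup>2"
      using rat(3)[of "k - Suc j"] True by (simp add: \<rho>_def Suc_diff_Suc)
    also have "\<dots> \<le> 5 * real k / L\<^sup>2" by (intro divide_right_mono) auto
    also have "\<dots> = 5 * (r / L)" by (simp add: r_def power2_eq_square)
    finally have "\<bar>\<rho> j - real (k - j) / L\<bar> \<le> 5 * (r / L)" .
    moreover have "real (k - j) / L = r - real j / L"
      using True by (simp add: r_def of_nat_diff diff_divide_distrib)
    moreover have "real j / L \<ge> 0" using L by simp
    ultimately show ?thesis by linarith
  next
    case False
    then have "j = k" using that by simp
    then have "\<rho> j = 0" "real j / L = r" by (auto simp: \<rho>_def r_def)
    with r r_L show ?thesis by simp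
  qed
  have \<rho>0: "\<rho> 0 \<le> 2 * r"
  proof -
    have "r / L \<le> r / 5" using r L by (intro divide_left_mono) auto
    moreover have "\<bar>\<rho> 0 - r\<bar> \<le> 5 * (r / L)" using \<rho>_close[of 0] by simp
    ultimately show ?thesis by linarith
  qed
  \<comment> \<open>From the first step on the quotient carries a factor r. This turns the drift j /
    L in \<open>\<rho>_close\<close> into a multiple of r / L.\<close>
  have T_small: "esym_quot N k (Suc j) \<le> 2 * r * (8/5) ^ j" for j
  proof (induction j)
    case 0
    then show ?case using \<rho>0 by (simp add: T_Suc[of 0] T_0)
  next
    case (Suc j)
    have "\<rho> (Suc j) * esym_quot N k (Suc j) \<le> (8/5) * (2 * r * (8/5) ^ j)"
      using Suc r by (intro mult_mono \<rho> nn) auto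
    then show ?case by (simp add: T_Suc[of "Suc j"])
  qed
  show "\<bar>esym_quot N k j - r ^ j\<bar> \<le> 20 * real j ^ 2 * (r / L) * (8/5) ^ j"
  proof (induction j)
    case 0
    then show ?case by (simp add: T_0)
  next
    case (Suc j)
    have step: "\<bar>\<rho> j - r\<bar> * esym_quot N k j \<le> 20 * real (Suc j) * (r / L) * (8/5) ^ Suc j"
    proof (cases j)
      case 0
      then show ?thesis using \<rho>_close[of 0] r_L by (simp add: T_0)
    next
      case (Suc i)
      show ?thesis
      proof (cases "j \<le> k")
        case True
        have "\<bar>\<rho> j - r\<bar> \<le> (8 + real j) / L"
        proof -
          have "5 * (r / L) \<le> 8 / L" using r L by (simp add: divide_right_mono)
          then show ?thesis using \<rho>_close[OF True] by (simp add: add_divide_distrib)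
        qed
        hence "\<bar>\<rho> j - r\<bar> * esym_quot N k j \<le> (8 + real j) / L * (2 * r * (8/5) ^ i)"
          using T_small[of i] L Suc by (intro mult_mono nn) auto
        also have "\<dots> = (16 + 2 * real j) * (r / L) * (8/5) ^ i" by (simp add: field_simps)
        also have "\<dots> \<le> (20 * real (Suc j)) * (r / L) * (8/5) ^ Suc j"
          using r_L Suc by (intro mult_mono power_increasing mult_nonneg_nonneg) auto
        finally show ?thesis .
      next
        case False
        have "0 \<le> 20 * real (Suc j) * (r / L) * (8/5) ^ Suc j"
          using r_L by (intro mult_nonneg_nonneg) auto
        with False show ?thesis by (simp add: esym_quot_def)
      qed
    qed
    \<comment> \<open>The first summand is controlled by \<open>step\<close>, the second by the
      induction hypothesis and r <= 8/5; then (j + 1) + j^2 <= (j + 1)^2 closes the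
      induction.\<close>
    have "esym_quot N k (Suc j) - r ^ Suc j = (\<rho> j - r) * esym_quot N k j + r * (esym_quot N k j - r ^ j)"
      by (simp add: T_Suc algebra_simps)
    also have "\<bar>\<dots>\<bar> \<le> \<bar>\<rho> j - r\<bar> * esym_quot N k j + r * \<bar>esym_quot N k j - r ^ j\<bar>"
      using abs_triangle_ineq[of "(\<rho> j - r) * esym_quot N k j" "r * (esym_quot N k j - r ^ j)"] r nn[of j]
      by (simp add: abs_mult)
    also have "\<dots> \<le> 20 * real (Suc j) * (r / L) * (8/5) ^ Suc j
        + (8/5) * (20 * real j ^ 2 * (r / L) * (8/5) ^ j)"
      using r r_L Suc.IH by (intro add_mono step mult_mono) auto
    also have "\<dots> = 20 * (real (Suc j) + real j ^ 2) * ((r / L) * (8/5) ^ Suc j)"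
    proof -
      have "20 * real (Suc j) * u * (8/5 * p) + 8/5 * (20 * real j ^ 2 * u * p)
        = 20 * (real (Suc j) + real j ^ 2) * (u * (8/5 * p))" for u p :: real
        by (simp add: algebra_simps)
      then show ?thesis unfolding power_Suc .
    qed
    also have "\<dots> \<le> 20 * real (Suc j) ^ 2 * ((r / L) * (8/5) ^ Suc j)"
    proof (intro mult_right_mono mult_left_mono)
      show "0 \<le> (r / L) * (8/5) ^ Suc j" using r_L by (intro mult_nonneg_nonneg) auto
    qed (auto simp: power2_eq_square algebra_simps)
    finally show ?case by (simp add: mult.assoc)
  qed
qed

subsection \<open>The number of cycles\<close>

definition cycle_prob :: "nat \<Rightarrow> nat \<Rightarrow> real" where
  "cycle_prob n k = real (stirling n k) / fact n"

text \<open>The cutoff prevents truncated subtraction from producing spurious values, so that sums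
  over m and j may run over larger ranges.\<close>

definition shifted_cycle_prob :: "nat \<Rightarrow> nat \<Rightarrow> nat \<Rightarrow> nat \<Rightarrow> real" where
  "shifted_cycle_prob n k m j = (if m \<le> n \<and> j \<le> k then cycle_prob (n - m) (k - j) else 0)"

lemma cycle_prob_Suc_Suc: "cycle_prob (Suc N) (Suc k) = harm_esym N k / real (Suc N)"
  unfolding cycle_prob_def stirling_eq_harm_esym by simp

lemma cycle_prob_nonneg: "cycle_prob n k \<ge> 0"
  by (simp add: cycle_prob_def)

lemma cycle_prob_le_1: "cycle_prob n k \<le> 1"
proof (cases "k \<le> n")
  case True
  have "stirling n k \<le> (\<Sum>k\<le>n. stirling n k)"
    using True by (intro member_le_sum) auto
  then have "real (stirling n k) \<le> fact n"
    unfolding sum_stirling by (metis of_nat_fact of_nat_le_iff)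
  then show ?thesis by (simp add: cycle_prob_def)
qed (simp add: cycle_prob_def)

lemma stirling_pos: "1 \<le> k \<Longrightarrow> k \<le> n \<Longrightarrow> stirling n k > 0"
proof (induction n k rule: stirling.induct)
  case (4 n k)
  then show ?case
    by (cases "Suc k \<le> n") (auto simp: le_Suc_eq)
qed auto

text \<open>The Stirling numbers in this range are positive integers. The crude bound serves for
  bounded n.\<close>

lemma inverse_cycle_prob_le_fact:
  assumes "1 \<le> k" "k \<le> n"
  shows "cycle_prob n k > 0" "1 / cycle_prob n k \<le> fact n"
proof -
  have s: "real (stirling n k) \<ge> 1" using stirling_pos[OF assms] by linarith
  then show "cycle_prob n k > 0" by (simp add: cycle_prob_def)
  have "fact n / real (stirling n k) \<le> fact n / (1::real)" using s by (intro divide_left_mono) auto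
  then show "1 / cycle_prob n k \<le> fact n" by (simp add: cycle_prob_def)
qed

lemma shifted_cycle_prob_bounds: "0 \<le> shifted_cycle_prob n k m j" "shifted_cycle_prob n k m j \<le> 1"
  by (auto simp: shifted_cycle_prob_def cycle_prob_nonneg cycle_prob_le_1)

text \<open>Passing from N to M changes the normalisation by the factor 1 + d with d = m / (M + 1),
  and it removes m variables, a relative loss of at most 2 d. The bound d <= (m + 1)^2 / (N + 1) is
  uniform in m.\<close>

lemma harm_esym_rescale_diff:
  assumes "N = M + m" and le: "\<And>l. i = Suc l \<Longrightarrow> harm_esym N l \<le> 2 * harm_esym N i"
  shows "\<bar>real (Suc N) / real (Suc M) * harm_esym M i - harm_esym N i\<bar>
    \<le> 2 * real (Suc m) ^ 2 / real (Suc N) * harm_esym N i"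
proof -
  define d where "d = real m / real (Suc M)"
  have Nd: "real (Suc N) / real (Suc M) = 1 + d" by (simp add: d_def assms field_simps)
  have d0: "d \<ge> 0" by (simp add: d_def)
  have "real m * real (Suc N) \<le> real (Suc m) ^ 2 * real (Suc M)"
    by (simp add: assms algebra_simps power2_eq_square)
  then have d: "d \<le> real (Suc m) ^ 2 / real (Suc N)" by (simp add: d_def field_simps)
  have 1: "d * harm_esym N i \<le> real (Suc m) ^ 2 / real (Suc N) * harm_esym N i"
    using d by (rule mult_right_mono) simp
  have upper: "(1 + d) * harm_esym M i \<le> (1 + d) * harm_esym N i"
    using d0 by (intro mult_left_mono harm_esym_mono) (auto simp: assms)
  have lower: "harm_esym N i - harm_esym M i \<le> 2 * (d * harm_esym N i)"
  proof (cases i)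
    case 0
    then show ?thesis using d0 by simp
  next
    case (Suc l)
    have "harm_esym N i - harm_esym M i \<le> d * harm_esym N l"
      using harm_esym_diff[of M m l] by (simp add: Suc assms d_def)
    also have "\<dots> \<le> d * (2 * harm_esym N i)" using d0 le[OF Suc] by (intro mult_left_mono)
    finally show ?thesis by simp
  qed
  have "d * harm_esym M i \<ge> 0" using d0 by simp
  moreover have "2 * real (Suc m) ^ 2 / real (Suc N) * harm_esym N i
      = 2 * (real (Suc m) ^ 2 / real (Suc N) * harm_esym N i)" by simp
  moreover have "real (Suc m) ^ 2 / real (Suc N) * harm_esym N i \<ge> 0" by simp
  ultimately show ?thesis
    using 1 upper lower unfolding Nd distrib_right abs_le_iff by linarith
qed

text \<open>For m <= N and j <= k this is \<open>harm_esym_rescale_diff\<close> divided by e_k.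
  Otherwise both terms vanish, or m > N and the factor (m + 1)^2 / (N + 1) is at least N +
  1.\<close>

lemma shifted_cycle_prob_close:
  fixes N k m j :: nat
  defines "L \<equiv> ln (real (Suc N))"
  assumes L: "L \<ge> 64" and k: "real k \<le> 3 / 2 * L"
  shows "\<bar>shifted_cycle_prob (Suc N) (Suc k) m j / cycle_prob (Suc N) (Suc k) - esym_quot N k j\<bar>
     \<le> 2 * real (Suc m) ^ 2 / real (Suc N) * (9/5) ^ j" (is "\<bar>?Q - _\<bar> \<le> ?B * _")
proof -
  note eq = esym_quot_estimate(1,2)[OF L[unfolded L_def] k[unfolded L_def]]
  have pos: "harm_esym N i > 0" if "i \<le> k" for i
    using that k L_def by (intro harm_esym_pos[OF L[unfolded L_def]]) linarith
  have eq': "esym_quot N k j \<le> (9/5) ^ j" for j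
    using eq(2)[of j] power_mono[of "8/5::real" "9/5" j] by linarith
  consider (a) "m \<le> N" "j \<le> k" | (b) "m \<le> N" "j > k" | (c) "m > N" by linarith
  then show ?thesis
  proof cases
    case a
    define M i where "M = N - m" and "i = k - j"
    have M: "N = M + m" "Suc N - m = Suc M" "Suc k - j = Suc i"
      using a by (auto simp: M_def i_def)
    have le: "harm_esym N l \<le> 2 * harm_esym N i" if "i = Suc l" for l
    proof -
      have "real (Suc l) \<le> 3 / 2 * ln (real (Suc N))"
        using that k a L_def i_def by linarith
      from harm_esym_ratio_bounds(2)[OF L[unfolded L_def] this]
      have "harm_esym N l \<le> 8 / 5 * harm_esym N i"
        using pos[of i] that by (simp add: i_def field_simps)
      then show ?thesis using harm_esym_nonneg[of N i] by linarith
    qed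
    have "?Q = (real (Suc N) / real (Suc M) * harm_esym M i) / harm_esym N k"
      using a M by (simp add: shifted_cycle_prob_def cycle_prob_Suc_Suc del: of_nat_Suc)
    moreover have "esym_quot N k j = harm_esym N i / harm_esym N k"
      using a by (simp add: esym_quot_def i_def)
    ultimately have "\<bar>?Q - esym_quot N k j\<bar> = \<bar>real (Suc N) / real (Suc M) * harm_esym M i - harm_esym N i\<bar> / harm_esym N k"
      using pos[of k] by (simp only: diff_divide_distrib[symmetric] abs_divide abs_of_pos)
    also have "\<dots> \<le> (?B * harm_esym N i) / harm_esym N k"
      using harm_esym_rescale_diff[OF M(1) le] pos[of k] by (intro divide_right_mono) auto
    also have "\<dots> = ?B * esym_quot N k j" using a by (simp add: esym_quot_def i_def)
    also have "\<dots> \<le> ?B * (9/5) ^ j" by (intro mult_left_mono eq') auto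
    finally show ?thesis .
  next
    case b
    \<comment> \<open>At j = k + 1 the value is the probability of having no cycle on a nonempty
      set.\<close>
    have "shifted_cycle_prob (Suc N) (Suc k) m j = 0"
    proof (cases "j = Suc k")
      case True
      then show ?thesis using b by (simp add: shifted_cycle_prob_def cycle_prob_def)
    qed (use b in \<open>simp add: shifted_cycle_prob_def\<close>)
    then show ?thesis using b by (simp add: esym_quot_def)
  next
    case c
    \<comment> \<open>For m > N the only nonzero value belongs to the empty permutation, at m = N +
      1 and j = k + 1, where the quotient is (N + 1) / e_k.\<close>
    have "?Q \<le> real (Suc N) * (9/5) ^ j"
    proof (cases "m = Suc N \<and> j = Suc k")
      case True
      have "?Q = real (Suc N) * esym_quot N k k"
        using True by (simp add: shifted_cycle_prob_def cycle_prob_Suc_Suc esym_quot_def cycle_prob_def[of 0 0])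
      also have "\<dots> \<le> real (Suc N) * (9/5) ^ k" by (intro mult_left_mono eq') auto
      also have "\<dots> \<le> real (Suc N) * (9/5) ^ j" using True
        by (intro mult_left_mono power_increasing) auto
      finally show ?thesis .
    next
      case False
      have "shifted_cycle_prob (Suc N) (Suc k) m j = 0"
      proof (cases "m = Suc N \<and> j < Suc k")
        case True
        then show ?thesis by (cases "Suc k - j") (auto simp: shifted_cycle_prob_def cycle_prob_def)
      qed (use c False in \<open>auto simp: shifted_cycle_prob_def\<close>)
      then show ?thesis by simp
    qed
    moreover have "esym_quot N k j \<le> real (Suc N) * (9/5) ^ j"
      using order.trans[OF eq'[of j] mult_right_mono[of 1 "real (Suc N)" "(9/5) ^ j", simplified mult_1]]
      by simp
    moreover have "?Q \<ge> 0" by (simp add: shifted_cycle_prob_bounds cycle_prob_nonneg)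
    ultimately have "\<bar>?Q - esym_quot N k j\<bar> \<le> real (Suc N) * (9/5) ^ j"
      using eq(1)[of j] by linarith
    also have "real (Suc N) \<le> ?B"
    proof -
      have "real (Suc N) * real (Suc N) \<le> real (Suc m) * real (Suc m)"
        using c by (intro mult_mono) auto
      also have "\<dots> \<le> 2 * real (Suc m) ^ 2" by (simp add: power2_eq_square)
      finally show ?thesis by (simp add: field_simps)
    qed
    hence "real (Suc N) * (9/5) ^ j \<le> ?B * (9/5) ^ j" by (intro mult_right_mono) auto
    finally show ?thesis .
  qed
qed

section \<open>Uniform comparison of quotients of cycle probabilities with powers of r\<close>

lemma ln_squared_le:
  assumes "x \<ge> (1::real)"
  shows "(ln x)\<^sup>2 \<le> 4 * x"
proof -
  have "ln x = 2 * ln (sqrt x)" using assms by (simp add: ln_sqrt)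
  also have "\<dots> \<le> 2 * sqrt x" using assms ln_le_minus_one[of "sqrt x"] by simp
  finally have "(ln x)\<^sup>2 \<le> (2 * sqrt x)\<^sup>2" using assms by (intro power_mono) auto
  then show ?thesis using assms by (simp add: power_mult_distrib)
qed

text \<open>The gap between the bases 8/5 and 9/5 absorbs the factor j^2 from
  \<open>esym_quot_estimate\<close>.\<close>

lemma square_times_power_bound:
  obtains C :: real where "C \<ge> 0" "\<And>j::nat. real j ^ 2 * (8/5) ^ j \<le> C * (9/5) ^ j"
proof -
  have "(\<lambda>j::nat. real j ^ 2 * (8/9) ^ j) \<longlonglongrightarrow> 0"
    by real_asymp
  then have "Bseq (\<lambda>j::nat. real j ^ 2 * (8/9) ^ j)"
    by (intro convergent_imp_Bseq) (auto simp: convergent_def)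
  then obtain C where C: "C > 0" "\<And>j. norm (real j ^ 2 * (8/9::real) ^ j) \<le> C"
    by (auto simp: Bseq_def)
  show ?thesis
  proof (rule that[of C])
    fix j :: nat
    have "real j ^ 2 * (8/5) ^ j = (real j ^ 2 * (8/9) ^ j) * (9/5::real) ^ j"
      by (simp add: power_mult_distrib[symmetric])
    also have "\<dots> \<le> C * (9/5) ^ j" using C(2)[of j] by (intro mult_right_mono) auto
    finally show "real j ^ 2 * (8/5) ^ j \<le> C * (9/5) ^ j" .
  qed (use C in auto)
qed

text \<open>For ln n >= 64 the quotient is compared with \<open>esym_quot\<close> and this with r ^
  j; the first error contains 1 / n, which is at most 4 k / (ln n)^2. For smaller n both terms are
  at most a constant times (9/5) ^ j, and k / (ln n)^2 is bounded below.\<close>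

lemma shifted_cycle_prob_ratio:
  obtains C :: real where "C > 0"
    "\<And>n k m j :: nat. n \<ge> 2 \<Longrightarrow> 1 \<le> k \<Longrightarrow> k \<le> n \<Longrightarrow> (real k - 1) / ln (real n) \<le> 3/2 \<Longrightarrow>
      \<bar>shifted_cycle_prob n k m j / cycle_prob n k - ((real k - 1) / ln (real n)) ^ j\<bar>
        \<le> C * real (Suc m) ^ 2 * (9/5) ^ j * (real k / (ln (real n))\<^sup>2)"
proof -
  obtain C1 :: real where C1: "C1 \<ge> 0" "\<And>j::nat. real j ^ 2 * (8/5) ^ j \<le> C1 * (9/5) ^ j"
    by (rule square_times_power_bound) blast
  \<comment> \<open>\<open>M\<close> bounds all n with ln n < 64. In \<open>C\<close>, the first two
    summands serve large n, and the last one, with 4096 = 64^2, serves small n.\<close>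
  define M where "M = nat \<lceil>exp 64 :: real\<rceil>"
  define C where "C = 8 + 20 * C1 + 4096 * fact M"
  show ?thesis
  proof (rule that[of C])
    show "C > 0" using C1 by (simp add: C_def add_nonneg_pos)
  next
    fix n k m j :: nat
    assume n: "n \<ge> 2" and k: "1 \<le> k" "k \<le> n" and r: "(real k - 1) / ln (real n) \<le> 3/2"
    define L where "L = ln (real n)"
    have L: "L > 0" using n by (simp add: L_def)
    define r where "r = (real k - 1) / L"
    have r: "0 \<le> r" "r \<le> 3/2" using r k L by (auto simp: r_def L_def)
    define Y where "Y = real (Suc m) ^ 2 * ((9/5) ^ j * (real k / L\<^sup>2))"
    have Y0: "Y \<ge> 0" by (simp add: Y_def)
    have Yge: "x * (9/5) ^ j * (real k / L\<^sup>2) \<le> x * Y" if "x \<ge> 0" for x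
      unfolding Y_def mult.assoc
      using that mult_right_mono[of 1 "real (Suc m) ^ 2" "(9/5) ^ j * (real k / L\<^sup>2)"]
      by (intro mult_left_mono) auto
    have "\<bar>shifted_cycle_prob n k m j / cycle_prob n k - r ^ j\<bar> \<le> C * Y"
    proof (cases "L \<ge> 64")
      case True
      define N \<kappa> where "N = n - 1" and "\<kappa> = k - 1"
      have N: "n = Suc N" "k = Suc \<kappa>" using n k by (auto simp: N_def \<kappa>_def)
      have \<kappa>: "real \<kappa> \<le> 3/2 * L" "r = real \<kappa> / L"
        using r L by (auto simp: r_def N field_simps)
      have Ln: "1 / real n \<le> 4 * real k / L\<^sup>2"
      proof -
        have "L\<^sup>2 \<le> 4 * real n" using ln_squared_le[of "real n"] n by (simp add: L_def)
        also have "\<dots> \<le> 4 * real k * real n" using k by simp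
        finally have "L\<^sup>2 \<le> 4 * real k * real n" .
        then show ?thesis using n L by (simp add: field_simps)
      qed
      have "\<bar>shifted_cycle_prob n k m j / cycle_prob n k - esym_quot N \<kappa> j\<bar>
         \<le> 2 * real (Suc m) ^ 2 / real n * (9/5) ^ j"
        using shifted_cycle_prob_close[of N \<kappa> m j] True \<kappa> unfolding N L_def by simp
      also have "\<dots> = 2 * real (Suc m) ^ 2 * (9/5) ^ j * (1 / real n)" by simp
      also have "\<dots> \<le> 2 * real (Suc m) ^ 2 * (9/5) ^ j * (4 * real k / L\<^sup>2)"
        by (intro mult_left_mono Ln) auto
      also have "\<dots> = 8 * Y" by (simp add: Y_def)
      finally have 1: "\<bar>shifted_cycle_prob n k m j / cycle_prob n k - esym_quot N \<kappa> j\<bar> \<le> 8 * Y" .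
      have "\<bar>esym_quot N \<kappa> j - r ^ j\<bar> \<le> 20 * real j ^ 2 * (r / L) * (8/5) ^ j"
        using esym_quot_estimate(3)[of N \<kappa> j] True \<kappa> unfolding N L_def by simp
      also have "\<dots> = 20 * (real j ^ 2 * (8/5) ^ j) * (r / L)" by simp
      also have "\<dots> \<le> 20 * (C1 * (9/5) ^ j) * (real k / L\<^sup>2)"
      proof (intro mult_mono[of "20 * _"] mult_left_mono C1)
        show "r / L \<le> real k / L\<^sup>2" using L
          by (simp add: r_def power2_eq_square divide_right_mono)
      qed (use C1 r L in auto)
      also have "\<dots> \<le> 20 * C1 * Y" using Yge[of "20 * C1"] C1 by simp
      finally have 2: "\<bar>esym_quot N \<kappa> j - r ^ j\<bar> \<le> 20 * C1 * Y" .
      have "C * Y = 8 * Y + 20 * C1 * Y + 4096 * fact M * Y" by (simp add: C_def algebra_simps)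
      moreover have "4096 * fact M * Y \<ge> 0" using Y0 by simp
      ultimately show ?thesis using 1 2 by linarith
    next
      case False
      have "real n < exp 64" using False n exp_less_mono[of L 64] by (simp add: L_def)
      then have "n \<le> M" unfolding M_def by linarith
      then have fM: "(fact n :: real) \<le> fact M" by (rule fact_mono)
      have "shifted_cycle_prob n k m j / cycle_prob n k \<le> 1 / cycle_prob n k"
        by (intro divide_right_mono shifted_cycle_prob_bounds cycle_prob_nonneg)
      also have "\<dots> \<le> fact M" using inverse_cycle_prob_le_fact[OF k] fM by linarith
      finally have a: "shifted_cycle_prob n k m j / cycle_prob n k \<le> fact M" .
      have fM1: "(1::real) \<le> fact M" by (rule fact_ge_1)
      have p1: "(1::real) \<le> (9/5) ^ j" by simp
      have "r ^ j \<le> (9/5) ^ j" using r by (intro power_mono) auto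
      then have b: "r ^ j \<le> fact M * (9/5) ^ j"
        using mult_right_mono[OF fM1, of "(9/5) ^ j"] p1 by linarith
      have c: "shifted_cycle_prob n k m j / cycle_prob n k \<le> fact M * (9/5) ^ j"
        using a mult_left_mono[OF p1, of "fact M"] fM1 by linarith
      have "r ^ j \<ge> 0" "shifted_cycle_prob n k m j / cycle_prob n k \<ge> 0"
        using r by (auto simp: shifted_cycle_prob_bounds cycle_prob_nonneg)
      with b c have "\<bar>shifted_cycle_prob n k m j / cycle_prob n k - r ^ j\<bar> \<le> fact M * (9/5) ^ j"
        by linarith
      also have "\<dots> = fact M * (9/5) ^ j * 1" by simp
      also have "\<dots> \<le> fact M * (9/5) ^ j * (4096 * (real k / L\<^sup>2))"
      proof (intro mult_left_mono)
        have "L\<^sup>2 \<le> 64\<^sup>2" using L False by (intro power_mono) auto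
        also have "\<dots> \<le> 4096 * real k" using k by simp
        finally show "1 \<le> 4096 * (real k / L\<^sup>2)" using L by (simp add: field_simps)
      qed auto
      also have "\<dots> \<le> 4096 * fact M * Y" using Yge[of "4096 * fact M"] by (simp add: mult_ac)
      also have "\<dots> \<le> C * Y" using C1 Y0 by (intro mult_right_mono) (auto simp: C_def)
      finally show ?thesis .
    qed
    then show "\<bar>shifted_cycle_prob n k m j / cycle_prob n k - ((real k - 1) / ln (real n)) ^ j\<bar>
        \<le> C * real (Suc m) ^ 2 * (9/5) ^ j * (real k / (ln (real n))\<^sup>2)"
      by (simp add: r_def L_def Y_def mult.assoc)
  qed
qed

section \<open>Counting permutations by cycles through the insertion of one element\<close>

lemma permutation_orbit_eq:
  assumes "permutation p" "x \<in> orbit p y"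
  shows "orbit p x = orbit p y"
proof -
  have "y \<in> orbit p x"
    by (rule orbit_swap[OF permutation_self_in_orbit[OF assms(1)] assms(2)])
  show ?thesis
  proof (intro Set.equalityI Set.subsetI)
    fix z assume "z \<in> orbit p x"
    then show "z \<in> orbit p y" using assms(2) by (rule orbit_trans)
  next
    fix z assume "z \<in> orbit p y"
    then show "z \<in> orbit p x" using \<open>y \<in> orbit p x\<close> by (rule orbit_trans)
  qed
qed

text \<open>Composition with the transposition inserts a into the cycle of q through b, directly
  before b, and leaves the other cycles of q alone.\<close>

lemma orbit_transpose_comp:
  assumes "q permutes S" "a \<notin> S" "b \<in> S" "x \<in> S"
  defines "p \<equiv> Transposition.transpose a b \<circ> q"
  shows "orbit p x - {a} = orbit q x"
proof -
  have q: "q y \<in> S" if "y \<in> S" for y using that assms(1) by (simp add: permutes_in_image)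
  have qa: "q a = a" using assms by (simp add: permutes_not_in)
  have pa: "p a = b" by (simp add: p_def qa)
  have p: "p y = (if q y = b then a else q y)" if "y \<in> S" for y
    using q[OF that] assms by (auto simp: p_def Transposition.transpose_def)
  have sub: "orbit q x \<subseteq> S" using assms(1,4) by (rule permutes_orbit_subset)
  \<comment> \<open>Collapsing a to b turns a step of p into a step of q or into no step, which
    gives an invariant along the orbit of p.\<close>
  have 1: "(if y = a then b else y) \<in> orbit q x" if "y \<in> orbit p x" for y
    using that
  proof induction
    case base
    show ?case using p[OF assms(4)] q[OF assms(4)] assms(2)
      by (auto intro: orbit.base)
  next
    case (step y)
    show ?case
    proof (cases "y = a")
      case True
      with step.IH assms(2,3) show ?thesis by (auto simp: pa)
    next
      case False
      with step.IH have y: "y \<in> orbit q x" by simp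
      with sub have "y \<in> S" by blast
      with y orbit.step[OF y] p[OF this] q[OF this] assms(2) show ?thesis by auto
    qed
  qed
  have 2: "y \<in> orbit p x" if "y \<in> orbit q x" for y
    using that
  proof induction
    case base
    show ?case
    proof (cases "q x = b")
      case True
      then have "a \<in> orbit p x" using p[OF assms(4)] orbit.base[of p x] by simp
      from orbit.step[OF this] show ?thesis by (simp add: pa True)
    qed (use p[OF assms(4)] orbit.base[of p x] in simp)
  next
    case (step y)
    then have "y \<in> S" using sub by blast
    show ?case
    proof (cases "q y = b")
      case True
      then have "a \<in> orbit p x" using p[OF \<open>y \<in> S\<close>] orbit.step[OF step.IH] by simp
      from orbit.step[OF this] show ?thesis by (simp add: pa True)
    qed (use p[OF \<open>y \<in> S\<close>] orbit.step[OF step.IH] in simp)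
  qed
  show ?thesis
  proof (intro Set.equalityI Set.subsetI)
    fix y assume "y \<in> orbit p x - {a}"
    then show "y \<in> orbit q x" using 1[of y] by simp
  next
    fix y assume y: "y \<in> orbit q x"
    then have "y \<noteq> a" using sub assms(2) by blast
    then show "y \<in> orbit p x - {a}" using 2[OF y] by simp
  qed
qed

text \<open>For b in S, deleting a is a bijection from the orbits of the new permutation to those of
  q. For b = a the transposition is the identity and {a} is an additional orbit.\<close>

lemma card_orbits_insert:
  assumes "finite S" "a \<notin> S" "q permutes S"
  shows "b \<in> S \<Longrightarrow> card (orbit (Transposition.transpose a b \<circ> q) ` insert a S) = card (orbit q ` S)"
    and "card (orbit (Transposition.transpose a a \<circ> q) ` insert a S) = Suc (card (orbit q ` S))"
proof -
  assume b: "b \<in> S"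
  define p where "p = Transposition.transpose a b \<circ> q"
  have "p permutes insert a S" unfolding p_def
    using assms b by (intro permutes_compose permutes_swap_id permutes_imp_permutes_insert) auto
  then have perm: "permutation p" using assms(1) by (auto simp: permutation_permutes)
  have permq: "permutation q" using assms by (auto simp: permutation_permutes)
  have "q a = a" using assms by (simp add: permutes_not_in)
  then have "orbit p a = orbit p b"
    using permutation_orbit_step[OF perm, of a] by (simp add: p_def)
  then have eq: "orbit p ` insert a S = orbit p ` S" using b by auto
  note diff = orbit_transpose_comp[OF assms(3,2) b, folded p_def]
  have "inj_on (\<lambda>A. A - {a}) (orbit p ` S)"
  proof (rule inj_onI, elim imageE)
    fix A B x y assume *: "A - {a} = B - {a}" "A = orbit p x" "B = orbit p y" "x \<in> S" "y \<in> S"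
    have "x \<in> orbit q x" by (intro permutation_self_in_orbit permq)
    then have "x \<in> orbit p y" using * diff[of x] diff[of y] by blast
    then show "A = B" using * permutation_orbit_eq[OF perm] by simp
  qed
  then have "card ((\<lambda>A. A - {a}) ` orbit p ` S) = card (orbit p ` S)" by (rule card_image)
  also have "(\<lambda>A. A - {a}) ` orbit p ` S = orbit q ` S"
    using diff by (force simp: image_image)
  finally show "card (orbit p ` insert a S) = card (orbit q ` S)" by (simp only: eq)
next
  have "q a = a" using assms by (simp add: permutes_not_in)
  then have "orbit q a = {a}" by (simp add: orbit_eq_singleton_iff)
  moreover have "orbit q x \<subseteq> S" if "x \<in> S" for x
    using assms(3) that by (rule permutes_orbit_subset)
  ultimately have "orbit q a \<notin> orbit q ` S" using assms(2) by auto
  then show "card (orbit (Transposition.transpose a a \<circ> q) ` insert a S) = Suc (card (orbit q ` S))"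
    using assms(1) by simp
qed

text \<open>A permutation p of S with a added corresponds to b = p a together with q =
  \<open>transpose a b \<circ> p\<close>, which permutes S. By \<open>card_orbits_insert\<close>, b
  in S keeps the number of cycles and b = a adds one; this is the Stirling recursion.\<close>

lemma card_permutes_with_cycles:
  assumes "finite S"
  shows "card {p. p permutes S \<and> card (orbit p ` S) = k} = stirling (card S) k"
  using assms
proof (induction S arbitrary: k)
  case empty
  show ?case by (cases k) auto
next
  case (insert a S)
  define C where "C k = {p. p permutes S \<and> card (orbit p ` S) = k}" for k
  define g where "g = (\<lambda>(b, p). Transposition.transpose a b \<circ> p :: 'a \<Rightarrow> 'a)"
  have finC: "finite (C k)" for k unfolding C_def
    by (rule finite_subset[OF _ finite_permutations[OF insert.hyps(1)]]) auto
  have cardC: "card (C k) = stirling (card S) k" for k unfolding C_def by (rule insert.IH)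
  show ?case
  proof (cases k)
    case 0
    have "{p. p permutes insert a S \<and> card (orbit p ` insert a S) = k} = {}"
      using insert.hyps 0 by (auto simp: card_eq_0_iff)
    then show ?thesis using 0 insert.hyps by simp
  next
    case (Suc i)
    have *: "{p. p permutes insert a S \<and> card (orbit p ` insert a S) = k}
      = g ` (S \<times> C (Suc i) \<union> {a} \<times> C i)" (is "?L = ?R")
    proof (intro Set.set_eqI iffI)
      fix p assume "p \<in> ?L"
      then have p: "p permutes insert a S" "card (orbit p ` insert a S) = Suc i"
        using Suc by auto
      define b where "b = p a"
      define q where "q = Transposition.transpose a b \<circ> p"
      have q: "p = Transposition.transpose a b \<circ> q" "b \<in> insert a S" "q permutes S"
      proof -
        show "p = Transposition.transpose a b \<circ> q" by (simp add: q_def fun_eq_iff)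
        show "b \<in> insert a S" using permutes_in_image[OF p(1), of a] by (simp add: b_def)
        show "q permutes S" unfolding q_def b_def using p(1) by (rule permutes_insert_lemma)
      qed
      show "p \<in> ?R"
      proof (cases "b = a")
        case True
        then have "q \<in> C i" using card_orbits_insert(2)[OF insert.hyps(1,2) q(3)] p q
          by (simp add: C_def)
        then show ?thesis using q True by (auto simp: g_def intro!: image_eqI[of _ _ "(b, q)"])
      next
        case False
        then have "b \<in> S" using q by auto
        then have "q \<in> C (Suc i)" using card_orbits_insert(1)[OF insert.hyps(1,2) q(3)] p q
          by (simp add: C_def)
        then show ?thesis using q \<open>b \<in> S\<close> by (auto simp: g_def intro!: image_eqI[of _ _ "(b, q)"])
      qed
    next
      fix p assume "p \<in> ?R"
      then obtain b q where q: "p = Transposition.transpose a b \<circ> q" "(b \<in> S \<and> q \<in> C (Suc i)) \<or> (b = a \<and> q \<in> C i)"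
        by (auto simp: g_def)
      then have "q permutes S" "b \<in> insert a S" by (auto simp: C_def)
      then have "p permutes insert a S" unfolding q(1)
        by (intro permutes_compose permutes_swap_id permutes_imp_permutes_insert) auto
      moreover have "card (orbit p ` insert a S) = Suc i"
        using q(2) card_orbits_insert[OF insert.hyps(1,2) \<open>q permutes S\<close>] unfolding q(1)
        by (auto simp: C_def simp del: Transposition.transpose_same)
      ultimately show "p \<in> ?L" using Suc by simp
    qed
    have "inj_on g (S \<times> C (Suc i) \<union> {a} \<times> C i)"
    proof (rule inj_onI, clarify)
      fix b q c q' assume "(b, q) \<in> S \<times> C (Suc i) \<union> {a} \<times> C i" "(c, q') \<in> S \<times> C (Suc i) \<union> {a} \<times> C i"
        and eq: "g (b, q) = g (c, q')"
      then have "q permutes S" "q' permutes S" by (auto simp: C_def)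
      then have "q a = a" "q' a = a" using insert.hyps by (auto simp: permutes_not_in)
      then have "b = c" using fun_cong[OF eq, of a] by (simp add: g_def)
      moreover have "q = q'"
      proof
        fix x
        have "Transposition.transpose a c (q x) = Transposition.transpose a c (q' x)"
          using fun_cong[OF eq, of x] unfolding g_def \<open>b = c\<close> by (simp only: prod.case o_apply)
        then show "q x = q' x" by (metis Transposition.transpose_involutory)
      qed
      ultimately show "b = c \<and> q = q'" by simp
    qed
    then have "card ?L = card (S \<times> C (Suc i) \<union> {a} \<times> C i)"
      unfolding * by (rule card_image)
    also have "\<dots> = card (S \<times> C (Suc i)) + card ({a} \<times> C i)"
      using insert.hyps finC by (intro card_Un_disjoint) auto
    also have "\<dots> = card S * stirling (card S) (Suc i) + stirling (card S) i"
      by (simp add: card_cartesian_product cardC)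
    finally show ?thesis using insert.hyps Suc by simp
  qed
qed

lemma prob_num_cycles:
  "measure_pmf.prob (random_perm n) {p. num_cycles n p = k} = cycle_prob n k"
proof -
  have fin: "finite {p. p permutes {1..n}}" by (rule finite_permutations) simp
  have ne: "{p. p permutes {1..n}} \<noteq> {}" using permutes_id by blast
  have "{p. p permutes {1..n}} \<inter> {p. num_cycles n p = k}
      = {p. p permutes {1..n} \<and> card (orbit p ` {1..n}) = k}"
    by (auto simp: num_cycles_def)
  then show ?thesis
    unfolding random_perm_def measure_pmf_of_set[OF ne fin] cycle_prob_def
    using card_permutes_with_cycles[of "{1..n}" k] card_permutations[of "{1..n}" n] by simp
qed

subsection \<open>Exponentials of power series with polynomial coefficients\<close>

text \<open>
  The base has to exceed the bound \<open>8/5\<close> on the quotients in \<open>esym_quot_estimate\<close> and to stay below \<open>2\<close>,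
  where the factors of the linear polynomials have a pole for \<open>q = 2\<close>.
\<close>

definition wnorm :: "real poly \<Rightarrow> real" where
  "wnorm p = (\<Sum>i\<le>Polynomial.degree p. \<bar>Polynomial.coeff p i\<bar> * (9/5) ^ i)"

lemma wnorm_eq:
  assumes "Polynomial.degree p \<le> N"
  shows "wnorm p = (\<Sum>i\<le>N. \<bar>Polynomial.coeff p i\<bar> * (9/5) ^ i)"
  unfolding wnorm_def using assms
  by (intro sum.mono_neutral_left) (auto simp: coeff_eq_0)

lemma wnorm_nonneg [simp]: "wnorm p \<ge> 0"
  by (auto simp: wnorm_def intro!: sum_nonneg)

lemma wnorm_0 [simp]: "wnorm 0 = 0" and wnorm_1 [simp]: "wnorm 1 = 1"
  by (auto simp: wnorm_def)

lemma wnorm_add: "wnorm (p + q) \<le> wnorm p + wnorm q"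
proof -
  define N where "N = max (Polynomial.degree p) (Polynomial.degree q)"
  have "wnorm (p + q) = (\<Sum>i\<le>N. \<bar>Polynomial.coeff (p + q) i\<bar> * (9/5) ^ i)"
    by (rule wnorm_eq) (auto simp: N_def degree_add_le_max)
  also have "\<dots> \<le> (\<Sum>i\<le>N. \<bar>Polynomial.coeff p i\<bar> * (9/5) ^ i + \<bar>Polynomial.coeff q i\<bar> * (9/5) ^ i)"
    unfolding distrib_right[symmetric] by (intro sum_mono mult_right_mono) auto
  also have "\<dots> = wnorm p + wnorm q"
    by (simp add: sum.distrib wnorm_eq[of p N] wnorm_eq[of q N] N_def)
  finally show ?thesis .
qed

lemma wnorm_sum: "wnorm (\<Sum>i\<in>I. f i) \<le> (\<Sum>i\<in>I. wnorm (f i))"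
proof (induction I rule: infinite_finite_induct)
  case (insert x I)
  then show ?case using wnorm_add[of "f x" "sum f I"] by simp
qed auto

lemma wnorm_smult: "wnorm (Polynomial.smult c p) = \<bar>c\<bar> * wnorm p"
proof -
  have "wnorm (Polynomial.smult c p)
    = (\<Sum>i\<le>Polynomial.degree p. \<bar>Polynomial.coeff (Polynomial.smult c p) i\<bar> * (9/5) ^ i)"
    by (rule wnorm_eq) (rule degree_smult_le)
  then show ?thesis by (simp add: wnorm_def sum_distrib_left abs_mult mult.assoc)
qed

lemma wnorm_pCons: "wnorm (pCons a p) = \<bar>a\<bar> + 9/5 * wnorm p"
proof -
  have "wnorm (pCons a p)
    = (\<Sum>i\<le>Suc (Polynomial.degree p). \<bar>Polynomial.coeff (pCons a p) i\<bar> * (9/5) ^ i)"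
    by (rule wnorm_eq) (rule degree_pCons_le)
  then show ?thesis
    by (simp add: wnorm_def sum.atMost_Suc_shift sum_distrib_left mult_ac del: sum.atMost_Suc)
qed

lemma wnorm_mult: "wnorm (p * q) \<le> wnorm p * wnorm q"
proof (induction p)
  case (pCons a p)
  have "wnorm (pCons a p * q) \<le> wnorm (Polynomial.smult a q) + wnorm (pCons 0 (p * q))"
    unfolding mult_pCons_left by (rule wnorm_add)
  also have "\<dots> \<le> \<bar>a\<bar> * wnorm q + 9/5 * (wnorm p * wnorm q)"
    using pCons.IH by (simp add: wnorm_smult wnorm_pCons)
  finally show ?case by (simp add: wnorm_pCons algebra_simps)
qed auto

lemma wnorm_monom: "wnorm (Polynomial.monom a n) = \<bar>a\<bar> * (9/5) ^ n"
  by (induction n) (auto simp: monom_0 monom_Suc wnorm_pCons)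

lemma abs_poly_le_wnorm:
  assumes "\<bar>x\<bar> \<le> 9/5"
  shows "\<bar>poly p x\<bar> \<le> wnorm p"
  unfolding poly_altdef wnorm_def using assms
  by (intro order.trans[OF sum_abs] sum_mono) (auto simp: abs_mult power_abs intro!: mult_left_mono power_mono)

text \<open>The coefficients of \<open>exp (\<Sum>m\<ge>1. a\<^sub>m * u ^ m / m)\<close> as a power series in \<open>u\<close>.\<close>

fun exp_coeffs :: "(nat \<Rightarrow> real poly) \<Rightarrow> nat \<Rightarrow> real poly" where
  "exp_coeffs a 0 = 1"
| "exp_coeffs a (Suc n) = Polynomial.smult (1 / real (Suc n)) (\<Sum>i\<le>n. a (Suc i) * exp_coeffs a (n - i))"

section \<open>Cycle polynomials and logarithmic derivatives of power series\<close>

lemma of_nat_times_smult_inverse: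
  "of_nat (Suc n) * Polynomial.smult (1 / real (Suc n)) p = p"
  by (simp add: of_nat_poly del: of_nat_Suc)

text \<open>This is x (x + 1) ... (x + n - 1) / n!, the coefficient of u^n in (1 - u)^(-x).\<close>

definition cycle_poly :: "nat \<Rightarrow> real poly" where
  "cycle_poly n = (\<Sum>k\<le>n. Polynomial.monom (cycle_prob n k) k)"

lemma coeff_cycle_poly: "Polynomial.coeff (cycle_poly n) k = cycle_prob n k"
  by (auto simp: cycle_poly_def coeff_sum cycle_prob_def)

lemma cycle_poly_0: "cycle_poly 0 = 1"
  by (simp add: cycle_poly_def cycle_prob_def monom_0)

lemma cycle_poly_Suc:
  "of_nat (Suc n) * cycle_poly (Suc n) = of_nat n * cycle_poly n + [:0, 1:] * cycle_poly n"
proof (rule poly_eqI)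
  fix k
  have of_nat: "of_nat i * p = Polynomial.smult (real i) p" for i p by (simp add: of_nat_poly)
  show "Polynomial.coeff (of_nat (Suc n) * cycle_poly (Suc n)) k =
    Polynomial.coeff (of_nat n * cycle_poly n + [:0, 1:] * cycle_poly n) k"
  proof (cases k)
    case 0
    then show ?thesis
      by (cases n) (auto simp: of_nat coeff_cycle_poly cycle_prob_def simp del: of_nat_Suc)
  next
    case (Suc i)
    have "real (Suc n) * cycle_prob (Suc n) (Suc i) = real n * cycle_prob n (Suc i) + cycle_prob n i"
      by (simp add: cycle_prob_def del: of_nat_Suc) (simp add: add_divide_distrib)
    then show ?thesis using Suc
      by (simp add: of_nat coeff_cycle_poly coeff_pCons del: of_nat_Suc)
  qed
qed

text \<open>The coefficients of the equation g' = x / (1 - u) * g for g = (1 - u)^(-x).\<close>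

lemma cycle_poly_recurrence:
  "of_nat (Suc n) * cycle_poly (Suc n) = [:0, 1:] * (\<Sum>i\<le>n. cycle_poly i)"
proof (induction n)
  case 0
  then show ?case using cycle_poly_Suc[of 0] by simp
next
  case (Suc n)
  have "of_nat (Suc (Suc n)) * cycle_poly (Suc (Suc n))
    = of_nat (Suc n) * cycle_poly (Suc n) + [:0, 1:] * cycle_poly (Suc n)"
    by (rule cycle_poly_Suc)
  then show ?case unfolding Suc.IH by (simp add: distrib_left del: of_nat_Suc)
qed

text \<open>The equation f' = l f determines (n + 1) times the coefficient n + 1 from the earlier
  coefficients, and n + 1 can be cancelled for real polynomials.\<close>

lemma fps_logderiv_unique:
  fixes f g l :: "real poly fps"
  assumes "fps_deriv f = l * f" "fps_deriv g = l * g" "fps_nth f 0 = fps_nth g 0"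
  shows "f = g"
proof (rule fps_ext)
  fix n show "fps_nth f n = fps_nth g n"
  proof (induction n rule: less_induct)
    case (less n)
    show ?case
    proof (cases n)
      case 0
      then show ?thesis using assms by simp
    next
      case (Suc i)
      have "of_nat (Suc i) * fps_nth f (Suc i) = fps_nth (l * f) i"
        using arg_cong[OF assms(1), of "\<lambda>f. fps_nth f i"] by simp
      also have "\<dots> = fps_nth (l * g) i"
        unfolding fps_mult_nth using less Suc by (intro sum.cong) auto
      also have "\<dots> = of_nat (Suc i) * fps_nth g (Suc i)"
        using arg_cong[OF assms(2), of "\<lambda>f. fps_nth f i"] by simp
      finally show ?thesis unfolding Suc mult_cancel_left
        by (simp del: of_nat_Suc)
    qed
  qed
qed

text \<open>By the recurrence the series of \<open>F\<close> has logarithmic derivative l + x / (1 -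
  u), where l belongs to \<open>exp_coeffs a\<close> and x / (1 - u) to \<open>cycle_poly\<close>.
  The product of these two series satisfies the same equation with the same constant term.\<close>

lemma exp_coeffs_convolution:
  assumes rec: "\<And>n. of_nat n * F n = (\<Sum>m=1..n. (a m + [:0, 1:]) * F (n - m))" and "F 0 = 1"
  shows "F n = (\<Sum>m\<le>n. exp_coeffs a m * cycle_poly (n - m))"
proof -
  define f where "f = Abs_fps F"
  define e where "e = Abs_fps (exp_coeffs a)"
  define g where "g = Abs_fps cycle_poly"
  define l where "l = Abs_fps (\<lambda>n. a (Suc n))"
  define x :: "real poly fps" where "x = Abs_fps (\<lambda>n. [:0, 1:])"
  have f: "fps_deriv f = (l + x) * f"
  proof (rule fps_ext)
    fix n
    have "fps_nth (fps_deriv f) n = (\<Sum>m=1..Suc n. (a m + [:0, 1:]) * F (Suc n - m))"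
      using rec[of "Suc n"] by (simp add: f_def)
    also have "\<dots> = (\<Sum>i=0..n. (a (Suc i) + [:0, 1:]) * F (n - i))"
      using sum.shift_bounds_cl_Suc_ivl[of "\<lambda>m. (a m + [:0, 1:]) * F (Suc n - m)" 0 n] by simp
    also have "\<dots> = fps_nth ((l + x) * f) n"
      by (simp add: fps_mult_nth l_def x_def f_def)
    finally show "fps_nth (fps_deriv f) n = fps_nth ((l + x) * f) n" .
  qed
  have e: "fps_deriv e = l * e"
  proof (rule fps_ext)
    fix n
    have "fps_nth (fps_deriv e) n = of_nat (Suc n) * exp_coeffs a (Suc n)" by (simp add: e_def)
    also have "\<dots> = (\<Sum>i\<le>n. a (Suc i) * exp_coeffs a (n - i))"
      unfolding exp_coeffs.simps(2) by (rule of_nat_times_smult_inverse)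
    finally show "fps_nth (fps_deriv e) n = fps_nth (l * e) n"
      by (simp add: fps_mult_nth l_def e_def atLeast0AtMost)
  qed
  have g: "fps_deriv g = x * g"
  proof (rule fps_ext)
    fix n
    have "fps_nth (fps_deriv g) n = [:0, 1:] * (\<Sum>i\<le>n. cycle_poly i)"
      using cycle_poly_recurrence[of n] by (simp add: g_def)
    also have "(\<Sum>i\<le>n. cycle_poly i) = (\<Sum>i\<le>n. cycle_poly (n - i))"
      using sum.nat_diff_reindex[of cycle_poly "Suc n"] by (simp add: lessThan_Suc_atMost)
    also have "[:0, 1:] * \<dots> = fps_nth (x * g) n"
      unfolding sum_distrib_left by (simp add: fps_mult_nth x_def g_def atLeast0AtMost)
    finally show "fps_nth (fps_deriv g) n = fps_nth (x * g) n" .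
  qed
  have "fps_deriv (e * g) = (l + x) * (e * g)"
    by (simp add: e g algebra_simps)
  with f have "f = e * g"
    by (rule fps_logderiv_unique) (simp add: f_def e_def g_def assms cycle_poly_0)
  from arg_cong[OF this, of "\<lambda>f. fps_nth f n"] have "F n = fps_nth (e * g) n"
    by (simp add: f_def)
  then show ?thesis by (simp add: fps_mult_nth e_def g_def atLeast0AtMost)
qed

section \<open>Bounds for the coefficients of an exponential\<close>

lemma sum_linear_geometric_bounded:
  fixes x :: real
  assumes "0 \<le> x" "x < 1"
  shows "(\<Sum>i\<le>n. real (Suc i) * x ^ Suc i) \<le> 1 / (1 - x)\<^sup>2"
proof -
  have s: "(\<lambda>n. real (Suc n) * x ^ n) sums (1 / (1 - x)\<^sup>2)"
    using geometric_deriv_sums[of x] assms by simp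
  have "(\<Sum>i\<le>n. real (Suc i) * x ^ Suc i) \<le> (\<Sum>i\<le>n. real (Suc i) * x ^ i)"
    using assms by (intro sum_mono mult_left_mono) (auto simp: mult_left_le_one_le)
  also have "\<dots> \<le> (\<Sum>i. real (Suc i) * x ^ i)"
    using s assms by (intro sum_le_suminf) (auto simp: sums_iff)
  finally show ?thesis using s by (simp add: sums_iff)
qed

text \<open>With \<beta> = \<delta> / (1 - c \<theta>)^2 the recursion bounds the weighted norm at n
  + 1 by \<beta> / (n + 1) times any common bound of the earlier ones. Such a bound grows by a
  factor of at most \<open>M\<close> while n + 1 <= M and stays put afterwards. The second claim
  retains the factor \<delta>, which later carries 1/q.\<close>

lemma exp_coeffs_bound:
  fixes a :: "nat \<Rightarrow> real poly" and c \<theta> \<delta> :: real and M :: nat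
  assumes "c > 0" "\<theta> \<ge> 0" "c * \<theta> < 1" "\<delta> \<ge> 0"
    and a: "\<And>m. wnorm (a m) \<le> \<delta> * real m * \<theta> ^ m"
    and M: "\<delta> / (1 - c * \<theta>)\<^sup>2 \<le> real M" "M \<ge> 1"
  shows "wnorm (exp_coeffs a n) * c ^ n \<le> real M ^ M"
    and "n \<ge> 1 \<Longrightarrow> wnorm (exp_coeffs a n) * c ^ n \<le> \<delta> / (1 - c * \<theta>)\<^sup>2 * real M ^ M"
proof -
  define \<beta> where "\<beta> = \<delta> / (1 - c * \<theta>)\<^sup>2"
  define g where "g n = wnorm (exp_coeffs a n) * c ^ n" for n
  have g0: "g n \<ge> 0" for n using assms by (simp add: g_def)
  have \<beta>: "\<beta> \<ge> 0" "\<beta> \<le> real M" using assms by (auto simp: \<beta>_def)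
  have step: "g (Suc n) \<le> \<beta> / real (Suc n) * B" if B: "\<And>i. i \<le> n \<Longrightarrow> g i \<le> B" for n B
  proof -
    have B0: "B \<ge> 0" using B[of 0] g0[of 0] by simp
    have "g (Suc n) = 1 / real (Suc n) * (wnorm (\<Sum>i\<le>n. a (Suc i) * exp_coeffs a (n - i)) * c ^ Suc n)"
      by (simp add: g_def wnorm_smult del: of_nat_Suc)
    also have "\<dots> \<le> 1 / real (Suc n) * ((\<Sum>i\<le>n. wnorm (a (Suc i)) * wnorm (exp_coeffs a (n - i))) * c ^ Suc n)"
      using assms(1)
      by (intro mult_left_mono mult_right_mono order.trans[OF wnorm_sum] sum_mono wnorm_mult) auto
    also have "(\<Sum>i\<le>n. wnorm (a (Suc i)) * wnorm (exp_coeffs a (n - i))) * c ^ Suc n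
      = (\<Sum>i\<le>n. (wnorm (a (Suc i)) * c ^ Suc i) * g (n - i))"
      unfolding sum_distrib_right
    proof (intro sum.cong refl)
      fix i assume "i \<in> {..n}"
      then have c: "c ^ Suc n = c ^ Suc i * c ^ (n - i)" by (simp flip: power_add)
      show "wnorm (a (Suc i)) * wnorm (exp_coeffs a (n - i)) * c ^ Suc n
        = wnorm (a (Suc i)) * c ^ Suc i * g (n - i)" unfolding g_def c by (simp only: mult_ac)
    qed
    also have "\<dots> \<le> (\<Sum>i\<le>n. (\<delta> * (real (Suc i) * (c * \<theta>) ^ Suc i)) * B)"
    proof (rule sum_mono, rule mult_mono)
      fix i
      have "wnorm (a (Suc i)) * c ^ Suc i \<le> (\<delta> * real (Suc i) * \<theta> ^ Suc i) * c ^ Suc i"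
        using assms(1) by (intro mult_right_mono a) auto
      then show "wnorm (a (Suc i)) * c ^ Suc i \<le> \<delta> * (real (Suc i) * (c * \<theta>) ^ Suc i)"
        by (simp only: power_mult_distrib mult_ac)
    qed (use assms B g0 B0 in auto)
    also have "\<dots> = \<delta> * (\<Sum>i\<le>n. real (Suc i) * (c * \<theta>) ^ Suc i) * B"
      by (simp only: sum_distrib_left sum_distrib_right)
    also have "\<dots> \<le> \<delta> * (1 / (1 - c * \<theta>)\<^sup>2) * B"
      using assms B0 by (intro mult_right_mono mult_left_mono sum_linear_geometric_bounded) auto
    finally show ?thesis by (simp add: \<beta>_def divide_right_mono mult_left_mono mult_ac)
  qed
  have M1: "real M \<ge> 1" using M(2) by simp
  \<comment> \<open>The exponent stops at \<open>M\<close> because \<beta> / n <= 1 for n >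
    M.\<close>
  have g_le: "g n \<le> real M ^ min n M" for n
  proof (induction n rule: less_induct)
    case (less n)
    show ?case
    proof (cases n)
      case 0
      then show ?thesis by (simp add: g_def)
    next
      case (Suc i)
      have "g j \<le> real M ^ min i M" if "j \<le> i" for j
      proof -
        have "g j \<le> real M ^ min j M" using less[of j] that Suc by simp
        also have "\<dots> \<le> real M ^ min i M" using M1 that by (intro power_increasing) auto
        finally show ?thesis .
      qed
      from step[OF this] have *: "g (Suc i) \<le> \<beta> / real (Suc i) * real M ^ min i M" .
      show ?thesis
      proof (cases "Suc i \<le> M")
        case True
        have "\<beta> / real (Suc i) \<le> \<beta> / 1" using \<beta> by (intro divide_left_mono) auto
        then have "\<beta> / real (Suc i) * real M ^ min i M \<le> real M * real M ^ min i M"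
          using \<beta> by (intro mult_right_mono) auto
        with * True Suc show ?thesis by (simp add: min_def)
      next
        case False
        then have "\<beta> / real (Suc i) \<le> 1" using \<beta> by (simp add: field_simps)
        then have "\<beta> / real (Suc i) * real M ^ min i M \<le> 1 * real M ^ min i M"
          by (intro mult_right_mono) auto
        moreover have "min i M = M" "min n M = M" using False Suc by auto
        ultimately show ?thesis using * Suc by simp
      qed
    qed
  qed
  have g_le': "g n \<le> real M ^ M" for n
    using g_le[of n] power_increasing[of "min n M" M "real M"] M1 by simp
  then show "wnorm (exp_coeffs a n) * c ^ n \<le> real M ^ M" by (simp add: g_def)
  show "wnorm (exp_coeffs a n) * c ^ n \<le> \<delta> / (1 - c * \<theta>)\<^sup>2 * real M ^ M" if "n \<ge> 1"
  proof -
    obtain i where i: "n = Suc i" using \<open>n \<ge> 1\<close> by (cases n) auto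
    have "g n \<le> \<beta> / real (Suc i) * real M ^ M" unfolding i by (rule step) (rule g_le')
    also have "\<dots> \<le> \<beta> / 1 * real M ^ M"
      using \<beta> by (intro mult_right_mono divide_left_mono) auto
    finally show ?thesis by (simp add: g_def \<beta>_def)
  qed
qed

text \<open>In the termwise comparison by \<open>shifted_cycle_prob_ratio\<close> the weights (9/5)
  ^ j sum the coefficients of \<open>G m\<close> to \<open>wnorm (G m)\<close>, whose decay beats (m
  + 1)^2. The term m = 0 contributes no error, so the bound is proportional to \<open>D\<close>. As
  \<open>G\<close> is arbitrary, the constant is independent of the field.\<close>

lemma cycle_ratio_estimate:
  obtains C :: real where "C > 0"
    "\<And>(G :: nat \<Rightarrow> real poly) D (n::nat) (k::nat). G 0 = 1 \<Longrightarrow>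
      (\<And>m. m \<ge> 1 \<Longrightarrow> wnorm (G m) \<le> D * (100/101) ^ m) \<Longrightarrow>
      n \<ge> 2 \<Longrightarrow> 1 \<le> k \<Longrightarrow> k \<le> n \<Longrightarrow> (real k - 1) / ln (real n) \<le> 3/2 \<Longrightarrow>
      \<bar>(\<Sum>m\<le>n. \<Sum>j\<le>k. Polynomial.coeff (G m) j * cycle_prob (n - m) (k - j)) / cycle_prob n k
         - (\<Sum>m. poly (G m) ((real k - 1) / ln (real n)))\<bar>
      \<le> C * D * (real k / (ln (real n))\<^sup>2)"
proof -
  obtain C :: real where C: "C > 0"
    "\<And>n k m j :: nat. n \<ge> 2 \<Longrightarrow> 1 \<le> k \<Longrightarrow> k \<le> n \<Longrightarrow> (real k - 1) / ln (real n) \<le> 3/2 \<Longrightarrow>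
      \<bar>shifted_cycle_prob n k m j / cycle_prob n k - ((real k - 1) / ln (real n)) ^ j\<bar>
        \<le> C * real (Suc m) ^ 2 * (9/5) ^ j * (real k / (ln (real n))\<^sup>2)"
    by (rule shifted_cycle_prob_ratio) blast
  define u :: "nat \<Rightarrow> real" where "u m = real (Suc m) ^ 2 * (100/101) ^ m" for m
  have "u \<in> O(\<lambda>m. (199/200) ^ m)"
    unfolding u_def by real_asymp
  then have summ_u: "summable u"
    using summable_comparison_test_bigo[of "\<lambda>m. (199/200::real) ^ m" u] by auto
  show ?thesis
  proof (rule that[of "C * (\<Sum>m. u m)"])
    have "u m > 0" for m by (simp add: u_def)
    then show "C * (\<Sum>m. u m) > 0" by (intro mult_pos_pos C(1) suminf_pos[OF summ_u])
  next
    fix G :: "nat \<Rightarrow> real poly" and D :: real and n k :: nat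
    assume G: "G 0 = 1" and D: "\<And>m. m \<ge> 1 \<Longrightarrow> wnorm (G m) \<le> D * (100/101) ^ m"
      and n: "n \<ge> 2" and k: "1 \<le> k" "k \<le> n" and r32: "(real k - 1) / ln (real n) \<le> 3/2"
    define r where "r = (real k - 1) / ln (real n)"
    define K where "K = real k / (ln (real n))\<^sup>2"
    have r: "0 \<le> r" "r \<le> 3/2" using r32 n k by (auto simp: r_def)
    have K: "K \<ge> 0" by (simp add: K_def)
    have cp: "cycle_prob n k > 0" using inverse_cycle_prob_le_fact[OF k] by simp
    have D0: "D \<ge> 0" using order.trans[OF wnorm_nonneg D[of 1]] by simp
    \<comment> \<open>These terms vanish for m > n, so the finite sum becomes a series over all m
      and the tail of the series of \<open>poly (G m) r\<close> is estimated along with the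
      rest.\<close>
    define y where "y m = (\<Sum>j\<le>Polynomial.degree (G m). Polynomial.coeff (G m) j * shifted_cycle_prob n k m j) / cycle_prob n k" for m
    have y_eq: "y m = (\<Sum>j\<le>k. Polynomial.coeff (G m) j * cycle_prob (n - m) (k - j)) / cycle_prob n k"
      if "m \<le> n" for m
    proof -
      define N where "N = max k (Polynomial.degree (G m))"
      have "(\<Sum>j\<le>Polynomial.degree (G m). Polynomial.coeff (G m) j * shifted_cycle_prob n k m j)
        = (\<Sum>j\<le>N. Polynomial.coeff (G m) j * shifted_cycle_prob n k m j)"
        by (intro sum.mono_neutral_left) (auto simp: N_def coeff_eq_0)
      also have "\<dots> = (\<Sum>j\<le>k. Polynomial.coeff (G m) j * shifted_cycle_prob n k m j)"
        by (intro sum.mono_neutral_right) (auto simp: N_def shifted_cycle_prob_def)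
      also have "\<dots> = (\<Sum>j\<le>k. Polynomial.coeff (G m) j * cycle_prob (n - m) (k - j))"
        using that by (intro sum.cong) (auto simp: shifted_cycle_prob_def)
      finally show ?thesis by (simp add: y_def)
    qed
    have y_0: "y m = 0" if "m > n" for m using that by (simp add: y_def shifted_cycle_prob_def)
    have diff: "\<bar>y m - poly (G m) r\<bar> \<le> C * D * K * u m" for m
    proof (cases "m = 0")
      case True
      then have "y m = 1" using cp by (simp add: y_def G shifted_cycle_prob_def)
      then show ?thesis using True G C(1) D0 K by (simp add: u_def)
    next
      case False
      have "y m - poly (G m) r
        = (\<Sum>j\<le>Polynomial.degree (G m). Polynomial.coeff (G m) j * (shifted_cycle_prob n k m j / cycle_prob n k - r ^ j))"
        by (simp add: y_def poly_altdef sum_divide_distrib sum_subtractf right_diff_distrib)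
      also have "\<bar>\<dots>\<bar> \<le> (\<Sum>j\<le>Polynomial.degree (G m). \<bar>Polynomial.coeff (G m) j\<bar> * (C * real (Suc m) ^ 2 * (9/5) ^ j * K))"
        using C(2)[OF n k r32, folded r_def K_def]
        by (intro order.trans[OF sum_abs] sum_mono) (auto simp only: abs_mult intro!: mult_left_mono)
      also have "\<dots> = C * real (Suc m) ^ 2 * K * wnorm (G m)"
        unfolding wnorm_def sum_distrib_left by (intro sum.cong) (simp_all only: mult_ac)
      also have "\<dots> \<le> C * real (Suc m) ^ 2 * K * (D * (100/101) ^ m)"
        using False C(1) K by (intro mult_left_mono D mult_nonneg_nonneg) auto
      also have "\<dots> = C * D * K * u m" by (simp only: u_def mult_ac)
      finally show ?thesis .
    qed
    have summ: "summable (\<lambda>m. C * D * K * u m)" by (rule summable_mult) fact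
    have summ_diff: "summable (\<lambda>m. \<bar>y m - poly (G m) r\<bar>)"
      by (rule summable_comparison_test'[OF summ, of 0]) (use diff in simp)
    have summ_y: "summable y" by (rule summable_finite[of "{..n}"]) (use y_0 in auto)
    have "summable (\<lambda>m. y m - (y m - poly (G m) r))"
      by (intro summable_diff summ_y summable_rabs_cancel[OF summ_diff])
    then have summ_G: "summable (\<lambda>m. poly (G m) r)" by simp
    have "(\<Sum>m\<le>n. \<Sum>j\<le>k. Polynomial.coeff (G m) j * cycle_prob (n - m) (k - j)) / cycle_prob n k = (\<Sum>m\<le>n. y m)"
      using y_eq by (simp add: sum_divide_distrib)
    also have "\<dots> = (\<Sum>m. y m)" by (rule suminf_finite[symmetric]) (use y_0 in auto)
    finally have "\<bar>(\<Sum>m\<le>n. \<Sum>j\<le>k. Polynomial.coeff (G m) j * cycle_prob (n - m) (k - j)) / cycle_prob n k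
       - (\<Sum>m. poly (G m) r)\<bar> = \<bar>\<Sum>m. y m - poly (G m) r\<bar>"
      using suminf_diff[OF summ_y summ_G] by simp
    also have "\<dots> \<le> (\<Sum>m. \<bar>y m - poly (G m) r\<bar>)" by (rule summable_rabs[OF summ_diff])
    also have "\<dots> \<le> (\<Sum>m. C * D * K * u m)" by (intro suminf_le diff summ_diff summ)
    also have "\<dots> = C * (\<Sum>m. u m) * D * K" 
      using suminf_mult[OF summ_u, of "C * D * K"] by (simp only: mult_ac)
    finally show "\<bar>(\<Sum>m\<le>n. \<Sum>j\<le>k. Polynomial.coeff (G m) j * cycle_prob (n - m) (k - j)) / cycle_prob n k
         - (\<Sum>m. poly (G m) ((real k - 1) / ln (real n)))\<bar>
      \<le> C * (\<Sum>m. u m) * D * (real k / (ln (real n))\<^sup>2)" by (simp only: r_def K_def)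
  qed
qed

section \<open>Evaluation of power series at u = 1\<close>

lemma conv_radius_ge_geometric:
  fixes f :: "nat \<Rightarrow> real"
  assumes "c > 0" "\<And>n. \<bar>f n\<bar> * c ^ n \<le> B"
  shows "conv_radius f \<ge> ereal c"
proof (rule conv_radius_geI_ex)
  fix x :: real assume x: "0 < x" "ereal x < ereal c"
  have "summable (\<lambda>n. f n * x ^ n)"
  proof (rule summable_comparison_test'[of "\<lambda>n. B * (x / c) ^ n" 0])
    show "summable (\<lambda>n. B * (x / c) ^ n)" using x assms(1) by (intro summable_mult summable_geometric) auto
    fix n
    have "norm (f n * x ^ n) = (\<bar>f n\<bar> * c ^ n) * (x / c) ^ n"
      using x assms(1) by (simp add: abs_mult power_divide)
    also have "\<dots> \<le> B * (x / c) ^ n" using x assms by (intro mult_right_mono) auto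
    finally show "norm (f n * x ^ n) \<le> B * (x / c) ^ n" .
  qed
  then show "\<exists>z::real. norm z = x \<and> summable (\<lambda>n. f n * z ^ n)"
    using x by (intro exI[of _ x]) auto
qed

text \<open>The equation F' = E' F makes F exp (- E) constant on [0, 1]. Because c > 1, the point u
  = 1 lies inside both discs of convergence.\<close>

lemma suminf_exp_coeffs:
  fixes a :: "nat \<Rightarrow> real poly" and r c B :: real
  defines "y \<equiv> \<lambda>n. poly (exp_coeffs a n) r" and "\<alpha> \<equiv> \<lambda>n. poly (a n) r / real n"
  assumes c: "c > 1" and y: "\<And>n. \<bar>y n\<bar> * c ^ n \<le> B" and \<alpha>: "\<And>n. \<bar>\<alpha> n\<bar> * c ^ n \<le> B"
  shows "(\<Sum>n. y n) = exp (\<Sum>n. \<alpha> n)"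
proof -
  define F where "F = Abs_fps y"
  define E where "E = Abs_fps \<alpha>"
  have rad: "ereal 1 < ereal c" using c by simp
  have F: "fps_conv_radius F \<ge> ereal c" and E: "fps_conv_radius E \<ge> ereal c"
    unfolding fps_conv_radius_def F_def E_def using c y \<alpha>
    by (auto intro!: conv_radius_ge_geometric)
  have radF: "ereal (norm z) < fps_conv_radius F" and radE: "ereal (norm z) < fps_conv_radius E"
    and radE': "ereal (norm z) < fps_conv_radius (fps_deriv E)"
    if "z \<in> {0..1}" for z :: real
  proof -
    have "ereal (norm z) < ereal c" using that c by simp
    with F E show "ereal (norm z) < fps_conv_radius F" "ereal (norm z) < fps_conv_radius E"
      by (meson less_le_trans)+
    then show "ereal (norm z) < fps_conv_radius (fps_deriv E)"
      using fps_conv_radius_deriv[of E] by simp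
  qed
  have ode: "fps_deriv F = fps_deriv E * F"
  proof (rule fps_ext)
    fix n
    have "fps_nth (fps_deriv F) n = real (Suc n) * y (Suc n)" by (simp add: F_def)
    also have "\<dots> = (\<Sum>i\<le>n. poly (a (Suc i)) r * y (n - i))"
      by (simp add: y_def poly_sum del: of_nat_Suc)
    finally show "fps_nth (fps_deriv F) n = fps_nth (fps_deriv E * F) n"
      by (simp add: fps_mult_nth E_def F_def \<alpha>_def atLeast0AtMost del: of_nat_Suc)
  qed
  define g where "g z = eval_fps F z * exp (- eval_fps E z)" for z
  have deriv: "(g has_real_derivative 0) (at z)" if z: "z \<in> {0..1}" for z
  proof -
    have "(g has_real_derivative (eval_fps (fps_deriv F) z * exp (- eval_fps E z)
      + exp (- eval_fps E z) * (- eval_fps (fps_deriv E) z) * eval_fps F z)) (at z)"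
      unfolding g_def
      by (rule derivative_eq_intros has_field_derivative_eval_fps radF radE z refl)+
    also have "eval_fps (fps_deriv F) z = eval_fps (fps_deriv E) z * eval_fps F z"
      unfolding ode by (rule eval_fps_mult) (use radF radE' z in auto)
    finally show ?thesis by (simp add: mult_ac)
  qed
  have "continuous_on {0..1} g"
    by (rule DERIV_continuous_on[of _ _ "\<lambda>_. 0"]) (use deriv in \<open>auto intro: has_field_derivative_at_within\<close>)
  then have "g 1 = g 0"
    by (rule DERIV_isconst_end[rotated]) (use deriv in auto)
  \<comment> \<open>The constant term of \<open>E\<close> is 0, as division by \<open>real 0\<close>
    gives 0.\<close>
  moreover have "g 0 = 1" by (simp add: g_def eval_fps_at_0 F_def E_def y_def \<alpha>_def)
  ultimately have "g 1 = 1" by simp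
  then have "eval_fps F 1 = exp (eval_fps E 1)"
    by (simp add: g_def exp_minus field_simps)
  then show ?thesis by (simp add: eval_fps_def F_def E_def)
qed

lemma smult_sum_right: "Polynomial.smult c (\<Sum>i\<in>I. f i) = (\<Sum>i\<in>I. Polynomial.smult c (f i))"
  by (induction I rule: infinite_finite_induct) (auto simp: smult_add_right)

section \<open>Logarithms of Euler factors and weights of prime powers\<close>

lemma neg_ln_has_sum:
  fixes t :: real
  assumes "0 \<le> t" "t < 1"
  shows "((\<lambda>j. t ^ j / real j) has_sum (- ln (1 - t))) {1..}"
proof -
  have "(\<lambda>n. t ^ n / real n) sums (- ln (1 - t))"
    using sums_minus[OF ln_series'[of "- t"]] assms by simp
  then have "((\<lambda>n. t ^ n / real n) has_sum (- ln (1 - t))) UNIV"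
    by (rule sums_nonneg_imp_has_sum) (use assms in auto)
  \<comment> \<open>The term at j = 0 is a division by 0, hence 0.\<close>
  then show ?thesis by (rule has_sum_cong_neutral[THEN iffD1, rotated -1]) auto
qed

text \<open>\<open>N\<close> stands for the norm of an irreducible polynomial. The series of - ln (1
  - t) is taken at t = x / N and, multiplied by - x, at t = 1 / N.\<close>

lemma log_euler_factor_has_sum:
  fixes x N :: real
  assumes "0 \<le> x" "x < N" "1 < N"
  shows "((\<lambda>j. (x ^ j - x) / (real j * N ^ j)) has_sum ln (inverse (1 - x / N) * (1 - 1 / N) powr x)) {1..}"
proof -
  have "((\<lambda>j. (x / N) ^ j / real j) has_sum (- ln (1 - x / N))) {1..}"
    using assms by (intro neg_ln_has_sum) auto
  moreover have "((\<lambda>j. - x * ((1 / N) ^ j / real j)) has_sum (- x * (- ln (1 - 1 / N)))) {1..}"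
    using assms by (intro has_sum_cmult_right neg_ln_has_sum) auto
  ultimately have "((\<lambda>j. (x / N) ^ j / real j + - x * ((1 / N) ^ j / real j))
      has_sum (- ln (1 - x / N) + - x * (- ln (1 - 1 / N)))) {1..}"
    by (rule has_sum_add)
  also have "(\<lambda>j. (x / N) ^ j / real j + - x * ((1 / N) ^ j / real j)) = (\<lambda>j. (x ^ j - x) / (real j * N ^ j))"
    by (simp add: fun_eq_iff power_divide diff_divide_distrib mult_ac)
  also have "- ln (1 - x / N) + - x * (- ln (1 - 1 / N)) = ln (inverse (1 - x / N) * (1 - 1 / N) powr x)"
    using assms by (simp add: ln_mult ln_inverse ln_powr)
  finally show ?thesis .
qed

text \<open>For j >= 2 the exponent j d - d is positive, so one factor 1/q splits off and q is
  replaced by 2 in the remaining power. What is left is an inequality between numerical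
  powers.\<close>

lemma prime_power_weight_bound:
  fixes q :: real and d j :: nat
  assumes "q \<ge> 2" "d \<ge> 1" "j \<ge> 2"
  shows "q ^ d / q ^ (j * d) * (9/5) ^ j \<le> 4 / q * (19/20) ^ (j * d)"
proof -
  obtain i where i: "j = Suc (Suc i)" using assms(3) by (cases j; cases "j - 1") auto
  obtain e where e: "d = Suc e" using assms(2) by (cases d) auto
  define s where "s = j * d - d - 1"
  have s: "j * d = Suc s + d" by (simp add: s_def i e)
  have "q ^ d / q ^ (j * d) = 1 / (q * q ^ s)" using assms(1) by (simp add: s power_add)
  also have "\<dots> \<le> 1 / (q * 2 ^ s)"
    using assms(1) by (intro divide_left_mono mult_left_mono power_mono mult_pos_pos) auto
  also have "\<dots> = 2 / q * (2 ^ d / 2 ^ (j * d))" by (simp add: s power_add)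
  finally have 1: "q ^ d / q ^ (j * d) \<le> 2 / q * (2 ^ d / 2 ^ (j * d))" .
  have 2: "2 ^ d / 2 ^ (j * d) * (9/5::real) ^ j \<le> 2 * (19/20) ^ (j * d)"
  proof (cases "d = 1")
    case True
    have "(9/10 :: real) ^ j = (9/5) ^ j / 2 ^ j" by (simp flip: power_divide)
    then have "(2 / 2 ^ j * (9/5::real) ^ j) = 2 * (9/10) ^ j" by simp
    also have "\<dots> \<le> 2 * (19/20) ^ j" by (intro mult_left_mono power_mono) auto
    finally show ?thesis using True by simp
  next
    case False
    then have d2: "2 \<le> d" using assms(2) by simp
    \<comment> \<open>After squaring, d, j >= 2 allow both exponents 2 d and 2 j to be raised to j
      d; then 9/10 <= (19/20)^2 finishes.\<close>
    have "(2 ^ d / 2 ^ (j * d) * (9/5::real) ^ j)\<^sup>2 = 2 ^ (d * 2) * (9/5) ^ (j * 2) / (2 ^ (j * d)) ^ 2"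
      by (simp add: power_mult_distrib power_divide power_mult)
    also have "\<dots> \<le> 2 ^ (d * j) * (9/5) ^ (j * d) / (2 ^ (j * d)) ^ 2"
      using assms(3) d2 by (intro divide_right_mono mult_mono power_increasing mult_le_mono) auto
    also have "\<dots> = (9/10) ^ (j * d)"
      by (simp add: power2_eq_square mult.commute[of d j] flip: power_divide)
    also have "\<dots> \<le> ((19/20) ^ 2) ^ (j * d)" by (intro power_mono) (auto simp: power2_eq_square)
    also have "\<dots> = ((19/20) ^ (j * d))\<^sup>2" by (simp add: mult.commute flip: power_mult)
    finally have "2 ^ d / 2 ^ (j * d) * (9/5::real) ^ j \<le> (19/20) ^ (j * d)"
      by (rule power2_le_imp_le) auto
    then show ?thesis by (smt (verit) zero_le_power divide_nonneg_nonneg)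
  qed
  have "q ^ d / q ^ (j * d) * (9/5) ^ j \<le> 2 / q * (2 ^ d / 2 ^ (j * d)) * (9/5) ^ j"
    using 1 by (intro mult_right_mono) auto
  also have "\<dots> = 2 / q * (2 ^ d / 2 ^ (j * d) * (9/5) ^ j)" by (simp only: mult.assoc)
  also have "\<dots> \<le> 2 / q * (2 * (19/20) ^ (j * d))"
    using assms(1) by (intro mult_left_mono 2) auto
  finally show ?thesis by simp
qed

subsection \<open>Monic polynomials over a finite field\<close>

locale finite_nat_field = field R for R :: "nat ring" (structure) +
  assumes finite_carrier: "finite (carrier R)"
begin

abbreviation "A \<equiv> poly_ring R"
abbreviation "MI \<equiv> monic_irreducibles R"

sublocale UP: principal_domain A
  using univ_poly_is_principal[OF carrier_is_subfield] .

lemma zero_A: "\<zero>\<^bsub>A\<^esub> = []"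
  by (rule univ_poly_zero)

lemma monic_polys_eq:
  "monic_polys R n = (\<lambda>p. \<one> # p) ` {p. set p \<subseteq> carrier R \<and> length p = n}"
proof (intro Set.set_eqI iffI)
  fix f assume f: "f \<in> monic_polys R n"
  then obtain p where p: "f = \<one> # p" by (cases f) (auto simp: monic_polys_def)
  with f have "set p \<subseteq> carrier R" "length p = n"
    by (auto simp: monic_polys_def univ_poly_carrier[symmetric] polynomial_def)
  with p show "f \<in> (\<lambda>p. \<one> # p) ` {p. set p \<subseteq> carrier R \<and> length p = n}" by auto
qed (auto simp: monic_polys_def univ_poly_carrier[symmetric] polynomial_def)

lemma finite_monic_polys [simp]: "finite (monic_polys R n)"
  unfolding monic_polys_eq using finite_lists_length_eq[OF finite_carrier, of n]
  by simp

lemma card_monic_polys: "card (monic_polys R n) = card (carrier R) ^ n"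
  unfolding monic_polys_eq using card_lists_length_eq[OF finite_carrier, of n]
  by (subst card_image) (auto intro: inj_onI)

lemma monic_polysD:
  assumes "f \<in> monic_polys R n"
  shows "f \<in> carrier A" "f \<noteq> []" "hd f = \<one>" "degree f = n"
  using assms by (auto simp: monic_polys_def)

lemma MI_D:
  assumes "P \<in> MI"
  shows "P \<in> monic_polys R (degree P)" "pirreducible (carrier R) P" "degree P \<ge> 1"
    "P \<in> carrier A" "P \<noteq> []"
  using assms pirreducible_degree[OF carrier_is_subfield, of P]
  by (auto simp: monic_irreducibles_def monic_polys_def)

lemma degree_mult:
  assumes "f \<in> carrier A" "g \<in> carrier A" "f \<noteq> []" "g \<noteq> []"
  shows "degree (f \<otimes>\<^bsub>A\<^esub> g) = degree f + degree g" "hd (f \<otimes>\<^bsub>A\<^esub> g) = hd f \<otimes> hd g"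
    "f \<otimes>\<^bsub>A\<^esub> g \<noteq> []"
  using poly_mult_degree_eq[OF carrier_is_subring, of f g]
    poly_mult_lead_coeff[OF carrier_is_subring, of f g]
    poly_mult_integral[OF carrier_is_subring, of f g] assms
  unfolding univ_poly_carrier univ_poly_mult by auto

lemma hd_in_carrier:
  assumes "f \<in> carrier A" "f \<noteq> []"
  shows "hd f \<in> carrier R" "hd f \<noteq> \<zero>"
  using assms by (auto simp: univ_poly_carrier[symmetric] polynomial_def)

lemma monic_mult:
  assumes "f \<in> monic_polys R m" "g \<in> monic_polys R n"
  shows "f \<otimes>\<^bsub>A\<^esub> g \<in> monic_polys R (m + n)"
  using monic_polysD[OF assms(1)] monic_polysD[OF assms(2)] degree_mult[of f g]
  by (auto simp: monic_polys_def)

lemma monic_one: "\<one>\<^bsub>A\<^esub> \<in> monic_polys R 0"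
  by (auto simp: monic_polys_eq univ_poly_one)

lemma monic_0_iff: "f \<in> monic_polys R 0 \<longleftrightarrow> f = \<one>\<^bsub>A\<^esub>"
  by (auto simp: monic_polys_eq univ_poly_one)

lemma monic_pow:
  assumes "P \<in> monic_polys R d"
  shows "P [^]\<^bsub>A\<^esub> (j::nat) \<in> monic_polys R (j * d)"
proof (induction j)
  case (Suc j)
  then show ?case using monic_mult[OF Suc assms] by (simp add: add.commute)
qed (use monic_one in simp)

lemma monic_quotient:
  assumes "P \<in> monic_polys R m" "f \<in> monic_polys R n" "P pdivides f"
  obtains g where "f = P \<otimes>\<^bsub>A\<^esub> g" "g \<in> monic_polys R (n - m)" "m \<le> n"
proof -
  note P = monic_polysD[OF assms(1)] and f = monic_polysD[OF assms(2)]
  from assms(3) obtain g where g: "g \<in> carrier A" "f = P \<otimes>\<^bsub>A\<^esub> g"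
    unfolding pdivides_def factor_def by auto
  have "g \<noteq> []" using g f P UP.r_null[of P] unfolding zero_A by auto
  with degree_mult[OF P(1) g(1) P(2)] g f P hd_in_carrier[of g] that[of g] show ?thesis
    by (auto simp: monic_polys_def)
qed

lemma exists_monic_associate:
  assumes "f \<in> carrier A" "f \<noteq> []"
  obtains g where "g \<in> monic_polys R (degree f)" "g divides\<^bsub>A\<^esub> f"
proof -
  define c where "c = inv (hd f)"
  have c: "c \<in> carrier R" "c \<noteq> \<zero>" "c \<otimes> hd f = \<one>"
    using hd_in_carrier[OF assms] subfield_m_inv[OF carrier_is_subfield, of "hd f"]
    by (auto simp: c_def)
  have u: "[c] \<in> Units A" using c univ_poly_carrier_units by auto
  then have cA: "[c] \<in> carrier A" by (rule UP.Units_closed)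
  have "[c] \<otimes>\<^bsub>A\<^esub> f \<in> monic_polys R (degree f)"
    using degree_mult[OF cA assms(1) _ assms(2)] c assms cA by (auto simp: monic_polys_def)
  moreover have "f = ([c] \<otimes>\<^bsub>A\<^esub> f) \<otimes>\<^bsub>A\<^esub> inv\<^bsub>A\<^esub> [c]"
  proof -
    have "([c] \<otimes>\<^bsub>A\<^esub> f) \<otimes>\<^bsub>A\<^esub> inv\<^bsub>A\<^esub> [c] = f \<otimes>\<^bsub>A\<^esub> ([c] \<otimes>\<^bsub>A\<^esub> inv\<^bsub>A\<^esub> [c])"
      using cA assms(1) UP.Units_inv_closed[OF u] by (simp add: UP.m_ac)
    then show ?thesis using u assms(1) by simp
  qed
  then have "([c] \<otimes>\<^bsub>A\<^esub> f) divides\<^bsub>A\<^esub> f"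
    unfolding factor_def using UP.Units_inv_closed[OF u] by blast
  ultimately show ?thesis by (rule that)
qed

text \<open>A monic divisor of least positive degree is irreducible: a factor of smaller positive
  degree, made monic, would contradict minimality.\<close>

lemma exists_irreducible_factor:
  assumes "f \<in> monic_polys R n" "n \<ge> 1"
  obtains P where "P \<in> MI" "P pdivides f"
proof -
  define Q where "Q d \<longleftrightarrow> d \<ge> 1 \<and> (\<exists>P\<in>monic_polys R d. P pdivides f)" for d
  have fA: "f \<in> carrier A" using monic_polysD[OF assms(1)] by simp
  have "Q n" using assms UP.divides_refl[OF fA] by (auto simp: Q_def pdivides_def)
  define d where "d = (LEAST d. Q d)"
  have "Q d" unfolding d_def by (rule LeastI) fact
  then obtain P where P: "P \<in> monic_polys R d" "P pdivides f" "d \<ge> 1" by (auto simp: Q_def)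
  note PD = monic_polysD[OF P(1)]
  have "pirreducible (carrier R) P"
  proof (rule pirreducibleI[OF carrier_is_subring PD(1,2)])
    show "P \<notin> Units A" using P(3) PD(4) univ_poly_units'[OF carrier_is_subfield, of P] by linarith
  next
    fix q r assume qr: "q \<in> carrier A" "r \<in> carrier A" "P = q \<otimes>\<^bsub>A\<^esub> r"
    have ne: "q \<noteq> []" "r \<noteq> []"
      using qr PD(2) UP.r_null[of q] UP.l_null[of r] unfolding zero_A by auto
    have deg: "degree q + degree r = d" using degree_mult(1)[OF qr(1,2) ne] qr PD(4) by simp
    show "q \<in> Units A \<or> r \<in> Units A"
    proof (cases "degree q = 0")
      case True
      then show ?thesis using qr ne univ_poly_units'[OF carrier_is_subfield, of q] by auto
    next
      case False
      obtain g where g: "g \<in> monic_polys R (degree q)" "g divides\<^bsub>A\<^esub> q"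
        using exists_monic_associate[OF qr(1) ne(1)] .
      have "q divides\<^bsub>A\<^esub> P" using qr unfolding factor_def by auto
      then have "g divides\<^bsub>A\<^esub> f"
        using g(2) P(2) monic_polysD(1)[OF g(1)] unfolding pdivides_def
        by (meson UP.divides_trans)
      then have "Q (degree q)" using g False by (auto simp: Q_def pdivides_def)
      then have "d \<le> degree q" unfolding d_def by (rule Least_le)
      then have "degree r = 0" using deg by simp
      then show ?thesis using qr ne univ_poly_units'[OF carrier_is_subfield, of r] by auto
    qed
  qed
  then have "P \<in> MI" using P(1) by (auto simp: monic_irreducibles_def)
  then show ?thesis using P(2) by (rule that)
qed

section \<open>Multiplicities of irreducible factors\<close>

lemma pow_pdivides_degree:
  assumes "P \<in> MI" "f \<in> monic_polys R n" "P [^]\<^bsub>A\<^esub> (j::nat) pdivides f"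
  shows "j * degree P \<le> n" "j \<le> n"
proof -
  show *: "j * degree P \<le> n"
    using monic_quotient[OF monic_pow[OF MI_D(1)[OF assms(1)]] assms(2,3)] by metis
  have "j * 1 \<le> j * degree P" using MI_D(3)[OF assms(1)] by (intro mult_le_mono2)
  with * show "j \<le> n" by (metis mult_1_right order.trans)
qed

text \<open>The degree bounds the exponents, so the \<open>GREATEST\<close> in
  \<open>factor_multiplicity\<close> is attained; lower powers divide higher ones.\<close>

lemma pow_pdivides_iff:
  assumes "P \<in> MI" "f \<in> monic_polys R n"
  shows "P [^]\<^bsub>A\<^esub> j pdivides f \<longleftrightarrow> j \<le> factor_multiplicity R P f"
proof -
  have PA: "P \<in> carrier A" and fA: "f \<in> carrier A"
    using MI_D(4)[OF assms(1)] monic_polysD(1)[OF assms(2)] .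
  have 0: "P [^]\<^bsub>A\<^esub> (0::nat) pdivides f" using UP.one_divides[OF fA] by (simp add: pdivides_def)
  have max: "P [^]\<^bsub>A\<^esub> factor_multiplicity R P f pdivides f"
    unfolding factor_multiplicity_def
    by (rule GreatestI_nat[of _ 0 n]) (use 0 pow_pdivides_degree(2)[OF assms] in auto)
  show ?thesis
  proof
    assume "P [^]\<^bsub>A\<^esub> j pdivides f"
    then show "j \<le> factor_multiplicity R P f"
      unfolding factor_multiplicity_def
      by (rule Greatest_le_nat[where b = n]) (use pow_pdivides_degree(2)[OF assms] in auto)
  next
    assume "j \<le> factor_multiplicity R P f"
    from polynomial_pow_division[OF PA this] max show "P [^]\<^bsub>A\<^esub> j pdivides f"
      unfolding pdivides_def using PA by (meson UP.divides_trans UP.nat_pow_closed)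
  qed
qed

lemma pdivides_iff_multiplicity_pos:
  assumes "P \<in> MI" "f \<in> monic_polys R n"
  shows "P pdivides f \<longleftrightarrow> factor_multiplicity R P f \<ge> 1"
  using pow_pdivides_iff[OF assms, of 1] MI_D(4)[OF assms(1)] by simp

text \<open>The cofactor is a unit by irreducibility and monic, hence 1.\<close>

lemma MI_pdivides_imp_eq:
  assumes "P \<in> MI" "Q \<in> MI" "Q pdivides P"
  shows "Q = P"
proof -
  obtain g where g: "P = Q \<otimes>\<^bsub>A\<^esub> g" "g \<in> monic_polys R (degree P - degree Q)" "degree Q \<le> degree P"
    using monic_quotient[OF MI_D(1)[OF assms(2)] MI_D(1)[OF assms(1)] assms(3)] .
  have gA: "g \<in> carrier A" using monic_polysD(1)[OF g(2)] .
  have "Q \<notin> Units A" using pirreducibleE(2)[OF carrier_is_subring MI_D(4,2)] assms by blast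
  then have "g \<in> Units A"
    using pirreducibleE(3)[OF carrier_is_subring MI_D(4,2) MI_D(4) gA g(1)] assms by blast
  then have "degree g = 0" using univ_poly_units'[OF carrier_is_subfield] by blast
  then have "g = \<one>\<^bsub>A\<^esub>" using g(2) monic_polysD(4)[OF g(2)] monic_0_iff by simp
  then show ?thesis using g(1) MI_D(4)[OF assms(2)] by simp
qed

text \<open>For distinct P and Q, \<open>Q\<close> does not divide \<open>P\<close>, so powers of
  \<open>Q\<close> dividing the product already divide \<open>g\<close>. For Q = P one factor
  cancels.\<close>

lemma multiplicity_mult:
  assumes "P \<in> MI" "Q \<in> MI" "g \<in> monic_polys R n"
  shows "factor_multiplicity R Q (P \<otimes>\<^bsub>A\<^esub> g) = factor_multiplicity R Q g + (if Q = P then 1 else 0)"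
proof -
  note PA = MI_D(4)[OF assms(1)] and QA = MI_D(4)[OF assms(2)] and gA = monic_polysD(1)[OF assms(3)]
  have Pg: "P \<otimes>\<^bsub>A\<^esub> g \<in> monic_polys R (degree P + n)"
    using monic_mult[OF MI_D(1)[OF assms(1)] assms(3)] .
  note iff1 = pow_pdivides_iff[OF assms(2) Pg] and iff2 = pow_pdivides_iff[OF assms(2,3)]
  show ?thesis
  proof (cases "Q = P")
    case False
    then have "\<not> Q pdivides P" using MI_pdivides_imp_eq[OF assms(1,2)] by blast
    from pirreducible_pow_pdivides_iff[OF carrier_is_subfield QA PA gA MI_D(2)[OF assms(2)] this]
    have "j \<le> factor_multiplicity R Q (P \<otimes>\<^bsub>A\<^esub> g) \<longleftrightarrow> j \<le> factor_multiplicity R Q g" for j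
      using iff1 iff2 by simp
    from this[of "factor_multiplicity R Q g"] this[of "factor_multiplicity R Q (P \<otimes>\<^bsub>A\<^esub> g)"]
    show ?thesis using False by simp
  next
    case True
    have *: "P [^]\<^bsub>A\<^esub> Suc j pdivides (P \<otimes>\<^bsub>A\<^esub> g) \<longleftrightarrow> P [^]\<^bsub>A\<^esub> j pdivides g" for j
    proof -
      have pj: "P [^]\<^bsub>A\<^esub> j \<in> carrier A" using PA by simp
      have "P [^]\<^bsub>A\<^esub> Suc j = P \<otimes>\<^bsub>A\<^esub> P [^]\<^bsub>A\<^esub> j" using PA pj by (simp add: UP.m_comm)
      moreover have "P \<in> carrier A - {\<zero>\<^bsub>A\<^esub>}" using PA MI_D(5)[OF assms(1)] by (simp add: zero_A)
      ultimately show ?thesis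
        using UP.mult_divides[OF pj gA] UP.divides_mult[OF pj PA] by (auto simp: pdivides_def)
    qed
    have "Suc j \<le> factor_multiplicity R P (P \<otimes>\<^bsub>A\<^esub> g) \<longleftrightarrow> j \<le> factor_multiplicity R P g" for j
      using iff1[of "Suc j"] iff2[of j] *[of j] unfolding True by blast
    from this[of "factor_multiplicity R P g"]
      this[of "factor_multiplicity R P (P \<otimes>\<^bsub>A\<^esub> g) - 1"]
    show ?thesis unfolding True by auto
  qed
qed

definition prime_divisors :: "nat list \<Rightarrow> nat list set" where
  "prime_divisors f = {P \<in> MI. P pdivides f}"

lemma MI_degree_le_finite: "finite {P \<in> MI. degree P \<le> n}"
proof (rule finite_subset)
  show "{P \<in> MI. degree P \<le> n} \<subseteq> (\<Union>d\<le>n. monic_polys R d)" using MI_D(1) by auto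
qed simp

lemma finite_prime_divisors:
  assumes "f \<in> monic_polys R n"
  shows "finite (prime_divisors f)"
proof (rule finite_subset)
  show "prime_divisors f \<subseteq> {P \<in> MI. degree P \<le> n}"
    using pow_pdivides_degree(1)[OF _ assms, of _ 1] MI_D(4) by (auto simp: prime_divisors_def)
qed (rule MI_degree_le_finite)

lemma prime_divisors_mult:
  assumes "P \<in> MI" "g \<in> monic_polys R n"
  shows "prime_divisors (P \<otimes>\<^bsub>A\<^esub> g) = insert P (prime_divisors g)"
proof -
  have Pg: "P \<otimes>\<^bsub>A\<^esub> g \<in> monic_polys R (degree P + n)"
    using monic_mult[OF MI_D(1)[OF assms(1)] assms(2)] .
  show ?thesis
    using multiplicity_mult[OF assms(1) _ assms(2)] pdivides_iff_multiplicity_pos[OF _ Pg]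
      pdivides_iff_multiplicity_pos[OF _ assms(2)] assms(1)
    by (auto simp: prime_divisors_def split: if_splits)
qed

text \<open>The weight serves twice: the constant 1 gives \<open>Omega_mult\<close>, and the degree
  gives \<open>degree_eq_sum_multiplicities\<close>.\<close>

lemma weighted_multiplicity_mult:
  fixes w :: "nat list \<Rightarrow> nat"
  assumes "P \<in> MI" "g \<in> monic_polys R n"
  shows "(\<Sum>Q\<in>prime_divisors (P \<otimes>\<^bsub>A\<^esub> g). factor_multiplicity R Q (P \<otimes>\<^bsub>A\<^esub> g) * w Q)
    = w P + (\<Sum>Q\<in>prime_divisors g. factor_multiplicity R Q g * w Q)"
proof -
  have fin: "finite (prime_divisors g)" using finite_prime_divisors[OF assms(2)] .
  have "(\<Sum>Q\<in>prime_divisors (P \<otimes>\<^bsub>A\<^esub> g). factor_multiplicity R Q (P \<otimes>\<^bsub>A\<^esub> g) * w Q)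
    = (\<Sum>Q\<in>insert P (prime_divisors g). (factor_multiplicity R Q g + (if Q = P then 1 else 0)) * w Q)"
    unfolding prime_divisors_mult[OF assms]
    using assms multiplicity_mult[OF assms(1) _ assms(2)]
    by (intro sum.cong) (auto simp: prime_divisors_def)
  also have "\<dots> = (\<Sum>Q\<in>insert P (prime_divisors g). factor_multiplicity R Q g * w Q)
      + (\<Sum>Q\<in>insert P (prime_divisors g). if Q = P then w Q else 0)"
    unfolding sum.distrib[symmetric] by (intro sum.cong) auto
  also have "(\<Sum>Q\<in>insert P (prime_divisors g). if Q = P then w Q else 0) = w P"
    using fin by (subst sum.delta) auto
  also have "(\<Sum>Q\<in>insert P (prime_divisors g). factor_multiplicity R Q g * w Q)
    = (\<Sum>Q\<in>prime_divisors g. factor_multiplicity R Q g * w Q)"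
    using fin assms pdivides_iff_multiplicity_pos[OF _ assms(2), of P]
    by (intro sum.mono_neutral_right) (auto simp: prime_divisors_def)
  finally show ?thesis by simp
qed

lemma Omega_mult:
  assumes "P \<in> MI" "g \<in> monic_polys R n"
  shows "Omega R (P \<otimes>\<^bsub>A\<^esub> g) = Suc (Omega R g)"
  using weighted_multiplicity_mult[OF assms, of "\<lambda>_. 1"]
  by (simp add: Omega_def prime_divisors_def)

lemma Omega_pow_mult:
  assumes "P \<in> MI" "g \<in> monic_polys R n"
  shows "Omega R (P [^]\<^bsub>A\<^esub> j \<otimes>\<^bsub>A\<^esub> g) = j + Omega R g"
proof (induction j)
  case 0
  then show ?case using monic_polysD(1)[OF assms(2)] by simp
next
  case (Suc j)
  note PA = MI_D(4)[OF assms(1)] and gA = monic_polysD(1)[OF assms(2)]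
  have m: "P [^]\<^bsub>A\<^esub> j \<otimes>\<^bsub>A\<^esub> g \<in> monic_polys R (j * degree P + n)"
    by (intro monic_mult monic_pow MI_D(1) assms)
  have "P [^]\<^bsub>A\<^esub> Suc j \<otimes>\<^bsub>A\<^esub> g = P \<otimes>\<^bsub>A\<^esub> (P [^]\<^bsub>A\<^esub> j \<otimes>\<^bsub>A\<^esub> g)"
    using PA gA by (simp add: UP.m_ac)
  then show ?case using Omega_mult[OF assms(1) m] Suc.IH by simp
qed

lemma degree_eq_sum_multiplicities:
  assumes "f \<in> monic_polys R n"
  shows "(\<Sum>Q\<in>prime_divisors f. factor_multiplicity R Q f * degree Q) = n"
  using assms
proof (induction n arbitrary: f rule: less_induct)
  case (less n)
  show ?case
  proof (cases "n = 0")
    case True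
    have "prime_divisors f = {}"
    proof (rule ccontr)
      assume "prime_divisors f \<noteq> {}"
      then obtain Q where "Q \<in> MI" "Q pdivides f" by (auto simp: prime_divisors_def)
      then show False
        using pow_pdivides_degree(2)[OF _ less.prems, of Q 1] True MI_D(4)[of Q] by simp
    qed
    then show ?thesis using True by simp
  next
    case False
    then obtain P where P: "P \<in> MI" "P pdivides f"
      using exists_irreducible_factor[OF less.prems] by auto
    obtain g where g: "f = P \<otimes>\<^bsub>A\<^esub> g" "g \<in> monic_polys R (n - degree P)" "degree P \<le> n"
      using monic_quotient[OF MI_D(1)[OF P(1)] less.prems P(2)] .
    have "n - degree P < n" using False MI_D(3)[OF P(1)] by simp
    from less.IH[OF this g(2)] show ?thesis
      using weighted_multiplicity_mult[OF P(1) g(2), of degree] g by simp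
  qed
qed

section \<open>The generating polynomial of Omega and its recurrence\<close>

definition prime_powers :: "nat \<Rightarrow> (nat list \<times> nat) set" where
  "prime_powers m = {(P, j). P \<in> MI \<and> j \<ge> 1 \<and> j * degree P = m}"

definition omega_poly :: "nat \<Rightarrow> real poly" where
  "omega_poly n = (\<Sum>f\<in>monic_polys R n. Polynomial.monom 1 (Omega R f))"

text \<open>A von Mangoldt sum over degree m, in which P^j has weight deg P and the variable records
  j.\<close>

definition prime_power_poly :: "nat \<Rightarrow> real poly" where
  "prime_power_poly m = (\<Sum>(P, j)\<in>prime_powers m. Polynomial.monom (real (degree P)) j)"

lemma prime_powers_bounds:
  assumes "(P, j) \<in> prime_powers m"
  shows "degree P \<ge> 1" "j \<ge> 1" "degree P \<le> m" "j \<le> m" "m \<ge> 1"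
proof -
  from assms have *: "P \<in> MI" "j \<ge> 1" "j * degree P = m" by (auto simp: prime_powers_def)
  show "degree P \<ge> 1" by (rule MI_D(3)) fact
  with * show "j \<ge> 1" "degree P \<le> m" "j \<le> m" "m \<ge> 1"
    by (auto simp: Suc_le_eq)
qed

lemma finite_prime_powers [simp]: "finite (prime_powers m)"
proof (rule finite_subset)
  show "prime_powers m \<subseteq> {P \<in> MI. degree P \<le> m} \<times> {..m}"
  proof
    fix p assume p: "p \<in> prime_powers m"
    obtain P j where Pj: "p = (P, j)" by (cases p)
    with p prime_powers_bounds[of P j m] show "p \<in> {P \<in> MI. degree P \<le> m} \<times> {..m}"
      by (simp add: prime_powers_def)
  qed
qed (use MI_degree_le_finite in auto)

lemma sum_multiples_prime_power:
  assumes "(P, j) \<in> prime_powers m" "m \<le> n"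
  shows "(\<Sum>f\<in>{f \<in> monic_polys R n. P [^]\<^bsub>A\<^esub> j pdivides f}. Polynomial.monom 1 (Omega R f) :: real poly)
    = Polynomial.monom 1 j * omega_poly (n - m)"
proof -
  have P: "P \<in> MI" "j * degree P = m" using assms by (auto simp: prime_powers_def)
  have Pj: "P [^]\<^bsub>A\<^esub> j \<in> monic_polys R m" using monic_pow[OF MI_D(1)[OF P(1)], of j] P by simp
  note PjD = monic_polysD[OF Pj]
  have "bij_betw (\<lambda>g. P [^]\<^bsub>A\<^esub> j \<otimes>\<^bsub>A\<^esub> g) (monic_polys R (n - m))
      {f \<in> monic_polys R n. P [^]\<^bsub>A\<^esub> j pdivides f}"
  proof (intro bij_betw_imageI inj_onI Set.set_eqI iffI)
    fix g g' assume "g \<in> monic_polys R (n - m)" "g' \<in> monic_polys R (n - m)"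
      "P [^]\<^bsub>A\<^esub> j \<otimes>\<^bsub>A\<^esub> g = P [^]\<^bsub>A\<^esub> j \<otimes>\<^bsub>A\<^esub> g'"
    then show "g = g'" using UP.m_lcancel[of "P [^]\<^bsub>A\<^esub> j" g g'] PjD monic_polysD(1)
      by (simp add: zero_A)
  next
    fix f assume "f \<in> (\<lambda>g. P [^]\<^bsub>A\<^esub> j \<otimes>\<^bsub>A\<^esub> g) ` monic_polys R (n - m)"
    then obtain g where g: "g \<in> monic_polys R (n - m)" "f = P [^]\<^bsub>A\<^esub> j \<otimes>\<^bsub>A\<^esub> g" by auto
    then have "f \<in> monic_polys R n" using monic_mult[OF Pj g(1)] assms(2) by simp
    moreover have "P [^]\<^bsub>A\<^esub> j pdivides f"
      using g monic_polysD(1)[OF g(1)] unfolding pdivides_def factor_def by auto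
    ultimately show "f \<in> {f \<in> monic_polys R n. P [^]\<^bsub>A\<^esub> j pdivides f}" by simp
  next
    fix f assume f: "f \<in> {f \<in> monic_polys R n. P [^]\<^bsub>A\<^esub> j pdivides f}"
    then obtain g where "f = P [^]\<^bsub>A\<^esub> j \<otimes>\<^bsub>A\<^esub> g" "g \<in> monic_polys R (n - m)"
      using monic_quotient[OF Pj, of f n] by auto
    then show "f \<in> (\<lambda>g. P [^]\<^bsub>A\<^esub> j \<otimes>\<^bsub>A\<^esub> g) ` monic_polys R (n - m)" by auto
  qed
  from sum.reindex_bij_betw[OF this, of "\<lambda>f. Polynomial.monom 1 (Omega R f) :: real poly", symmetric]
  show ?thesis
    using Omega_pow_mult[OF P(1)]
    by (simp add: omega_poly_def sum_distrib_left mult_monom)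
qed

text \<open>The degree n of f is the sum of deg P over all prime powers P^j dividing f, since P
  occurs once for each j up to its multiplicity. Exchanging this sum with the sum over f leaves the
  multiples of P^j, handled by \<open>sum_multiples_prime_power\<close>.\<close>

lemma omega_poly_recurrence:
  "of_nat n * omega_poly n = (\<Sum>m=1..n. prime_power_poly m * omega_poly (n - m))"
proof -
  define U where "U = (\<Union>m\<in>{1..n}. prime_powers m)"
  define w :: "nat list \<Rightarrow> nat \<Rightarrow> nat list \<Rightarrow> real poly"
    where "w P j f = Polynomial.monom (real (degree P)) 0 * Polynomial.monom 1 (Omega R f)" for P j f
  have finU: "finite U" by (simp add: U_def)
  have div: "Sigma (prime_divisors f) (\<lambda>P. {1..factor_multiplicity R P f})
      = {p \<in> U. fst p [^]\<^bsub>A\<^esub> snd p pdivides f}"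
    if f: "f \<in> monic_polys R n" for f
  proof (rule Set.set_eqI)
    fix p :: "nat list \<times> nat"
    obtain P j where p: "p = (P, j)" by (cases p)
    have "p \<in> Sigma (prime_divisors f) (\<lambda>P. {1..factor_multiplicity R P f})
        \<longleftrightarrow> P \<in> MI \<and> P pdivides f \<and> 1 \<le> j \<and> j \<le> factor_multiplicity R P f"
      unfolding p prime_divisors_def mem_Sigma_iff atLeastAtMost_iff mem_Collect_eq by blast
    also have "\<dots> \<longleftrightarrow> P \<in> MI \<and> 1 \<le> j \<and> P [^]\<^bsub>A\<^esub> j pdivides f"
      using pow_pdivides_iff[OF _ f] pdivides_iff_multiplicity_pos[OF _ f] order.trans by blast
    also have "\<dots> \<longleftrightarrow> (P, j) \<in> U \<and> P [^]\<^bsub>A\<^esub> j pdivides f"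
    proof (intro iffI conjI)
      assume *: "P \<in> MI \<and> 1 \<le> j \<and> P [^]\<^bsub>A\<^esub> j pdivides f"
      then have m: "(P, j) \<in> prime_powers (j * degree P)" by (simp add: prime_powers_def)
      have "j * degree P \<in> {1..n}"
        using prime_powers_bounds(5)[OF m] pow_pdivides_degree(1)[OF _ f, of P j] * by simp
      then show "(P, j) \<in> U" using m unfolding U_def by blast
    qed (auto simp: U_def prime_powers_def)
    finally show "p \<in> Sigma (prime_divisors f) (\<lambda>P. {1..factor_multiplicity R P f})
        \<longleftrightarrow> p \<in> {p \<in> U. fst p [^]\<^bsub>A\<^esub> snd p pdivides f}"
      by (simp add: p)
  qed
  have deg: "of_nat n * Polynomial.monom 1 (Omega R f) = (\<Sum>p\<in>{p \<in> U. fst p [^]\<^bsub>A\<^esub> snd p pdivides f}. w (fst p) (snd p) f)"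
    if f: "f \<in> monic_polys R n" for f
  proof -
    have "(\<Sum>p\<in>Sigma (prime_divisors f) (\<lambda>P. {1..factor_multiplicity R P f}). w (fst p) (snd p) f)
      = (\<Sum>P\<in>prime_divisors f. \<Sum>j\<in>{1..factor_multiplicity R P f}. w P j f)"
      using finite_prime_divisors[OF f] by (simp add: sum.Sigma case_prod_unfold)
    also have "\<dots> = (\<Sum>P\<in>prime_divisors f. of_nat (factor_multiplicity R P f * degree P) * Polynomial.monom 1 (Omega R f))"
      by (intro sum.cong) (auto simp: w_def mult_monom of_nat_poly smult_monom monom_0)
    also have "\<dots> = of_nat n * Polynomial.monom 1 (Omega R f)"
      unfolding sum_distrib_right[symmetric] of_nat_sum[symmetric] degree_eq_sum_multiplicities[OF f] ..
    finally show ?thesis unfolding div[OF f] ..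
  qed
  have "of_nat n * omega_poly n = (\<Sum>f\<in>monic_polys R n. \<Sum>p\<in>{p \<in> U. fst p [^]\<^bsub>A\<^esub> snd p pdivides f}. w (fst p) (snd p) f)"
    unfolding omega_poly_def sum_distrib_left using deg by (rule sum.cong[OF refl])
  also have "\<dots> = (\<Sum>p\<in>U. \<Sum>f\<in>{f \<in> monic_polys R n. fst p [^]\<^bsub>A\<^esub> snd p pdivides f}. w (fst p) (snd p) f)"
    using finU by (intro sum.swap_restrict) auto
  also have "\<dots> = (\<Sum>m\<in>{1..n}. \<Sum>p\<in>prime_powers m. \<Sum>f\<in>{f \<in> monic_polys R n. fst p [^]\<^bsub>A\<^esub> snd p pdivides f}. w (fst p) (snd p) f)"
    unfolding U_def
  proof (rule sum.UNION_disjoint)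
    show "\<forall>i\<in>{1..n}. \<forall>j\<in>{1..n}. i \<noteq> j \<longrightarrow> prime_powers i \<inter> prime_powers j = {}"
      unfolding prime_powers_def by blast
  qed simp_all
  also have "\<dots> = (\<Sum>m=1..n. prime_power_poly m * omega_poly (n - m))"
  proof (intro sum.cong refl)
    fix m assume m: "m \<in> {1..n}"
    have "(\<Sum>f\<in>{f \<in> monic_polys R n. fst p [^]\<^bsub>A\<^esub> snd p pdivides f}. w (fst p) (snd p) f)
      = (case p of (P, j) \<Rightarrow> Polynomial.monom (real (degree P)) j) * omega_poly (n - m)"
      if "p \<in> prime_powers m" for p
    proof -
      obtain P j where p: "p = (P, j)" by (cases p)
      have "(\<Sum>f\<in>{f \<in> monic_polys R n. P [^]\<^bsub>A\<^esub> j pdivides f}. w P j f)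
        = Polynomial.monom (real (degree P)) 0 *
          (\<Sum>f\<in>{f \<in> monic_polys R n. P [^]\<^bsub>A\<^esub> j pdivides f}. Polynomial.monom 1 (Omega R f))"
        unfolding w_def sum_distrib_left ..
      also have "\<dots> = Polynomial.monom (real (degree P)) 0 * (Polynomial.monom 1 j * omega_poly (n - m))"
        using sum_multiples_prime_power[OF that[unfolded p]] m by (simp only: atLeastAtMost_iff)
      also have "\<dots> = Polynomial.monom (real (degree P)) j * omega_poly (n - m)"
        by (simp only: mult.assoc[symmetric] mult_monom mult_1_right add_0)
      finally show ?thesis unfolding p by (simp only: fst_conv snd_conv prod.case)
    qed
    then show "(\<Sum>p\<in>prime_powers m. \<Sum>f\<in>{f \<in> monic_polys R n. fst p [^]\<^bsub>A\<^esub> snd p pdivides f}. w (fst p) (snd p) f)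
      = prime_power_poly m * omega_poly (n - m)"
      unfolding prime_power_poly_def sum_distrib_right by (rule sum.cong[OF refl])
  qed
  finally show ?thesis .
qed

text \<open>The exact prime polynomial theorem. At x = 1 the generating polynomial is q^n, and
  subtracting q times the recurrence at l from the one at l + 1 isolates the sum for m = l +
  1.\<close>

lemma sum_degree_prime_powers:
  assumes "m \<ge> 1"
  shows "(\<Sum>(P, j)\<in>prime_powers m. real (degree P)) = real (card (carrier R)) ^ m"
proof -
  define q where "q = real (card (carrier R))"
  define s where "s m = poly (prime_power_poly m) 1" for m
  have om: "poly (omega_poly n) 1 = q ^ n" for n
    by (simp add: omega_poly_def poly_sum poly_monom card_monic_polys q_def)
  have rec: "real n * q ^ n = (\<Sum>m=1..n. s m * q ^ (n - m))" for n
    using arg_cong[OF omega_poly_recurrence[of n], of "\<lambda>p. poly p 1"]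
    by (simp add: poly_sum om s_def)
  obtain l where m: "m = Suc l" using assms by (cases m) auto
  have "real (Suc l) * q ^ Suc l = (\<Sum>m=1..l. s m * q ^ (Suc l - m)) + s (Suc l)"
    using rec[of "Suc l"] by simp
  also have "(\<Sum>m=1..l. s m * q ^ (Suc l - m)) = q * (\<Sum>m=1..l. s m * q ^ (l - m))"
    unfolding sum_distrib_left by (intro sum.cong) (auto simp: Suc_diff_le)
  also have "\<dots> = q * (real l * q ^ l)" unfolding rec ..
  finally have "s m = q ^ m" by (simp add: m algebra_simps)
  then show ?thesis
    by (simp add: s_def q_def prime_power_poly_def poly_sum case_prod_unfold poly_monom)
qed

subsection \<open>The Euler product\<close>

abbreviation "q \<equiv> real (card (carrier R))"

lemma q_ge_2: "q \<ge> 2"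
proof -
  have "card {\<zero>, \<one>} \<le> card (carrier R)" by (intro card_mono finite_carrier) auto
  then show ?thesis by simp
qed

lemma poly_norm_ge_2:
  assumes "P \<in> MI"
  shows "poly_norm R P \<ge> 2"
proof -
  have "q ^ 1 \<le> q ^ degree P" using MI_D(3)[OF assms] q_ge_2 by (intro power_increasing) simp_all
  then show ?thesis using q_ge_2 unfolding poly_norm_def power_one_right by linarith
qed

text \<open>The pairs are grouped by j. The group j = 1 vanishes, and each j >= 2 is bounded by
  \<open>prime_power_weight_bound\<close>; the number of values of j gives the factor m. The
  function \<phi> will be a norm or an absolute value of x^j - x.\<close>

lemma sum_prime_powers_le:
  fixes \<phi> :: "nat \<Rightarrow> real"
  assumes \<phi>1: "\<phi> 1 = 0" and \<phi>: "\<And>j. j \<ge> 2 \<Longrightarrow> \<phi> j \<le> 2 * (9/5) ^ j"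
  shows "(\<Sum>p\<in>prime_powers m. real (degree (fst p)) / q ^ m * \<phi> (snd p)) \<le> 8 / q * real m * (19/20) ^ m"
proof -
  have q0: "q > 0" using q_ge_2 by simp
  have "(\<Sum>p\<in>prime_powers m. real (degree (fst p)) / q ^ m * \<phi> (snd p))
    = (\<Sum>j\<in>{1..m}. \<Sum>p\<in>{p \<in> prime_powers m. snd p = j}. real (degree (fst p)) / q ^ m * \<phi> (snd p))"
  proof (rule sum.group[symmetric])
    show "snd ` prime_powers m \<subseteq> {1..m}"
    proof (rule image_subsetI)
      fix p assume "p \<in> prime_powers m"
      then have "(fst p, snd p) \<in> prime_powers m" by simp
      from prime_powers_bounds(2,4)[OF this] show "snd p \<in> {1..m}" by simp
    qed
  qed simp_all
  also have "\<dots> \<le> (\<Sum>j\<in>{1..m}. 8 / q * (19/20) ^ m)"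
  proof (rule sum_mono)
    fix j assume j: "j \<in> {1..m}"
    define V where "V = {p \<in> prime_powers m. snd p = j}"
    have R0: "0 \<le> 8 / q * (19/20) ^ m" using q0 by simp
    consider "V = {}" | "j = 1" | "V \<noteq> {}" "j \<ge> 2" using j by fastforce
    then have "(\<Sum>p\<in>V. real (degree (fst p)) / q ^ m * \<phi> (snd p)) \<le> 8 / q * (19/20) ^ m"
    proof cases
      case 1
      then show ?thesis using R0 by (simp only: sum.empty)
    next
      case 2
      then have "(\<Sum>p\<in>V. real (degree (fst p)) / q ^ m * \<phi> (snd p)) = 0"
        unfolding V_def by (intro sum.neutral) (simp add: \<phi>1[simplified])
      then show ?thesis using R0 by linarith
    next
      case 3
      then obtain P where "(P, j) \<in> prime_powers m" by (fastforce simp: V_def)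
      then obtain d where m: "m = j * d" and d: "d \<ge> 1"
        using prime_powers_bounds(1) unfolding prime_powers_def by blast
      have j0: "j > 0" using 3 by simp
      \<comment> \<open>Replacing (P, j) by (P, 1) embeds \<open>V\<close> into
        \<open>prime_powers d\<close>, whose degrees sum to q^d.\<close>
      have "(\<Sum>p\<in>V. real (degree (fst p))) = (\<Sum>p\<in>(\<lambda>p. (fst p, 1::nat)) ` V. real (degree (fst p)))"
        by (subst sum.reindex) (auto simp: V_def inj_on_def prod_eq_iff)
      also have "\<dots> \<le> (\<Sum>p\<in>prime_powers d. real (degree (fst p)))"
      proof (rule sum_mono2)
        show "(\<lambda>p. (fst p, 1::nat)) ` V \<subseteq> prime_powers d"
        proof (rule image_subsetI)
          fix p assume "p \<in> V"
          then have p: "fst p \<in> MI" "j * degree (fst p) = j * d"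
            unfolding V_def prime_powers_def m mem_Collect_eq case_prod_unfold by blast+
          from p(2) j0 have "degree (fst p) = d" by (simp only: mult_cancel1) blast
          with p(1) show "(fst p, 1) \<in> prime_powers d" by (simp add: prime_powers_def)
        qed
      qed simp_all
      also have "\<dots> = q ^ d"
        using sum_degree_prime_powers[OF d] by (simp only: case_prod_unfold)
      finally have S: "(\<Sum>p\<in>V. real (degree (fst p))) \<le> q ^ d" .
      have "(\<Sum>p\<in>V. real (degree (fst p)) / q ^ m * \<phi> (snd p)) \<le> (\<Sum>p\<in>V. real (degree (fst p)) / q ^ m * (2 * (9/5) ^ j))"
        using \<phi>[OF 3(2)] q0 unfolding V_def by (intro sum_mono mult_left_mono) simp_all
      also have "\<dots> = (\<Sum>p\<in>V. real (degree (fst p))) / q ^ m * (2 * (9/5) ^ j)"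
        by (simp only: sum_divide_distrib sum_distrib_right)
      also have "\<dots> \<le> q ^ d / q ^ m * (2 * (9/5) ^ j)"
        using S q0 by (intro mult_right_mono divide_right_mono) simp_all
      also have "\<dots> = 2 * (q ^ d / q ^ (j * d) * (9/5) ^ j)" by (simp only: m mult_ac)
      also have "\<dots> \<le> 2 * (4 / q * (19/20) ^ (j * d))"
        by (intro mult_left_mono prime_power_weight_bound q_ge_2 d 3) simp
      also have "\<dots> = 8 / q * (19/20) ^ m" by (simp add: m)
      finally show ?thesis .
    qed
    then show "(\<Sum>p\<in>{p \<in> prime_powers m. snd p = j}. real (degree (fst p)) / q ^ m * \<phi> (snd p)) \<le> 8 / q * (19/20) ^ m"
      unfolding V_def .
  qed
  also have "\<dots> = 8 / q * real m * (19/20) ^ m" by simp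
  finally show ?thesis .
qed

text \<open>The a_m(x) of the overview. Subtracting x for each prime power takes out the factor (1 -
  u)^(-x) and cancels the terms j = 1.\<close>

definition log_coeff :: "nat \<Rightarrow> real poly" where
  "log_coeff m = (\<Sum>p\<in>prime_powers m. Polynomial.smult (real (degree (fst p)) / q ^ m)
     (Polynomial.monom 1 (snd p) - Polynomial.monom 1 1))"

lemma wnorm_log_coeff: "wnorm (log_coeff m) \<le> 8 / q * real m * (19/20) ^ m"
proof -
  define \<phi> where "\<phi> j = wnorm (Polynomial.monom 1 j - Polynomial.monom 1 1)" for j
  have "\<phi> j \<le> 2 * (9/5) ^ j" if "j \<ge> 2" for j
  proof -
    have "\<phi> j \<le> wnorm (Polynomial.monom 1 j) + wnorm (Polynomial.smult (-1) (Polynomial.monom 1 1))"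
      unfolding \<phi>_def using wnorm_add[of "Polynomial.monom 1 j" "Polynomial.smult (-1) (Polynomial.monom 1 1)"]
      by simp
    also have "\<dots> = (9/5) ^ j + (9/5) ^ 1" by (simp only: wnorm_smult wnorm_monom abs_one abs_minus_cancel mult_1)
    also have "(9/5::real) ^ 1 \<le> (9/5) ^ j" using that by (intro power_increasing) simp_all
    finally show ?thesis by simp
  qed
  moreover have "\<phi> 1 = 0" by (simp add: \<phi>_def)
  ultimately have *: "(\<Sum>p\<in>prime_powers m. real (degree (fst p)) / q ^ m * \<phi> (snd p)) \<le> 8 / q * real m * (19/20) ^ m"
    by (intro sum_prime_powers_le)
  have "wnorm (log_coeff m) \<le> (\<Sum>p\<in>prime_powers m. real (degree (fst p)) / q ^ m * \<phi> (snd p))"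
    unfolding log_coeff_def
    by (rule order.trans[OF wnorm_sum]) (simp add: wnorm_smult \<phi>_def)
  with * show ?thesis by linarith
qed

text \<open>The weights deg P / q^m sum to 1, so the terms subtracted in \<open>log_coeff\<close>
  amount to exactly x.\<close>

lemma prime_power_poly_eq:
  assumes "m \<ge> 1"
  shows "Polynomial.smult (1 / q ^ m) (prime_power_poly m) = log_coeff m + [:0, 1:]"
proof -
  have q0: "q > 0" using q_ge_2 by simp
  have x: "Polynomial.monom 1 1 = [:0, 1 :: real:]" by (simp add: monom_Suc monom_0)
  have "(\<Sum>p\<in>prime_powers m. real (degree (fst p)) / q ^ m) = 1"
    using sum_degree_prime_powers[OF assms] q0
    by (simp add: sum_divide_distrib[symmetric] case_prod_unfold)
  then have "(\<Sum>p\<in>prime_powers m. Polynomial.smult (real (degree (fst p)) / q ^ m) [:0, 1:]) = [:0, 1:]"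
    by (simp only: smult_sum[symmetric] smult_1_left)
  then have "log_coeff m + [:0, 1:] = (\<Sum>p\<in>prime_powers m. Polynomial.smult (real (degree (fst p)) / q ^ m) (Polynomial.monom 1 (snd p)))"
    unfolding log_coeff_def x smult_diff_right sum_subtractf by (simp only: diff_add_cancel)
  also have "\<dots> = Polynomial.smult (1 / q ^ m) (prime_power_poly m)"
    unfolding prime_power_poly_def smult_sum_right case_prod_unfold by (simp add: smult_monom)
  finally show ?thesis by simp
qed

lemma omega_poly_0: "omega_poly 0 = 1"
proof -
  have "{P \<in> MI. P pdivides \<one>\<^bsub>A\<^esub>} = {}"
  proof (rule ccontr)
    assume "{P \<in> MI. P pdivides \<one>\<^bsub>A\<^esub>} \<noteq> {}"
    then obtain P where P: "P \<in> MI" "P pdivides \<one>\<^bsub>A\<^esub>" by blast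
    show False using pow_pdivides_degree(2)[OF P(1) monic_one, of 1] P MI_D(4)[OF P(1)] by simp
  qed
  then have "Omega R \<one>\<^bsub>A\<^esub> = 0" unfolding Omega_def by (simp only: sum.empty)
  moreover have "monic_polys R 0 = {\<one>\<^bsub>A\<^esub>}" using monic_0_iff by blast
  ultimately show ?thesis by (simp add: omega_poly_def monom_0)
qed

lemma scaled_omega_poly:
  "Polynomial.smult (1 / q ^ n) (omega_poly n)
    = (\<Sum>m\<le>n. exp_coeffs log_coeff m * cycle_poly (n - m))"
proof (rule exp_coeffs_convolution)
  fix n
  have q0: "q > 0" using q_ge_2 by simp
  have "of_nat n * Polynomial.smult (1 / q ^ n) (omega_poly n)
    = Polynomial.smult (1 / q ^ n) (\<Sum>m=1..n. prime_power_poly m * omega_poly (n - m))"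
    unfolding omega_poly_recurrence[symmetric] by simp
  also have "\<dots> = (\<Sum>m=1..n. Polynomial.smult (1 / q ^ m) (prime_power_poly m) * Polynomial.smult (1 / q ^ (n - m)) (omega_poly (n - m)))"
    unfolding smult_sum_right
  proof (rule sum.cong[OF refl])
    fix m assume "m \<in> {1..n}"
    then have "q ^ n = q ^ m * q ^ (n - m)" by (simp flip: power_add)
    then show "Polynomial.smult (1 / q ^ n) (prime_power_poly m * omega_poly (n - m)) =
      Polynomial.smult (1 / q ^ m) (prime_power_poly m) * Polynomial.smult (1 / q ^ (n - m)) (omega_poly (n - m))"
      by (simp add: mult_ac)
  qed
  also have "\<dots> = (\<Sum>m=1..n. (log_coeff m + [:0, 1:]) * Polynomial.smult (1 / q ^ (n - m)) (omega_poly (n - m)))"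
    by (rule sum.cong[OF refl]) (simp add: prime_power_poly_eq)
  finally show "of_nat n * Polynomial.smult (1 / q ^ n) (omega_poly n) = \<dots>" .
qed (simp add: omega_poly_0)

lemma prob_Omega:
  "measure_pmf.prob (random_monic R n) {f. Omega R f = k}
    = (\<Sum>m\<le>n. \<Sum>j\<le>k. Polynomial.coeff (exp_coeffs log_coeff m) j * cycle_prob (n - m) (k - j))"
proof -
  have q0: "q > 0" using q_ge_2 by simp
  have ne: "monic_polys R n \<noteq> {}"
  proof
    assume "monic_polys R n = {}"
    with card_monic_polys[of n] q0 show False by simp
  qed
  have "measure_pmf.prob (random_monic R n) {f. Omega R f = k}
    = real (card (monic_polys R n \<inter> {f. Omega R f = k})) / q ^ n"
    unfolding random_monic_def by (simp add: measure_pmf_of_set[OF ne] card_monic_polys)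
  also have "real (card (monic_polys R n \<inter> {f. Omega R f = k})) = Polynomial.coeff (omega_poly n) k"
    by (simp add: omega_poly_def coeff_sum sum.If_cases Int_def)
  also have "\<dots> / q ^ n = Polynomial.coeff (Polynomial.smult (1 / q ^ n) (omega_poly n)) k" by simp
  also have "\<dots> = (\<Sum>m\<le>n. \<Sum>j\<le>k. Polynomial.coeff (exp_coeffs log_coeff m) j * cycle_prob (n - m) (k - j))"
    unfolding scaled_omega_poly by (simp add: coeff_sum coeff_mult coeff_cycle_poly)
  finally show ?thesis .
qed

text \<open>The double series over pairs (P, j) converges absolutely. Collected by the degree m of
  P^j it is the exponent on the right; collected by P it is the sum of the logarithms of the Euler
  factors, which \<open>exp\<close> turns into the product.\<close>

lemma h_eq_exp:
  assumes x: "0 \<le> x" "x \<le> 3/2"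
  shows "h R x = exp (\<Sum>m. poly (log_coeff m) x / real m)"
proof -
  define f where "f p = (x ^ snd p - x) / (real (snd p) * poly_norm R (fst p) ^ snd p)" for p
  define W where "W = Sigma UNIV prime_powers"
  have q0: "q > 0" using q_ge_2 by simp
  have f_eq: "f p = real (degree (fst p)) / q ^ m * (x ^ snd p - x) / real m" if "p \<in> prime_powers m" for p m
  proof -
    obtain P j where p: "p = (P, j)" by (cases p)
    note b = prime_powers_bounds[OF that[unfolded p]]
    have m: "m = j * degree P" using that unfolding p prime_powers_def by blast
    have "poly_norm R P ^ j = q ^ m" by (simp add: poly_norm_def m mult.commute flip: power_mult)
    moreover have "real m = real j * real (degree P)" by (simp only: m of_nat_mult)
    moreover have "real (degree P) > 0" using b(1) by simp
    ultimately show ?thesis using q0 by (simp add: f_def p)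
  qed
  have fib: "(\<Sum>p\<in>prime_powers m. f p) = poly (log_coeff m) x / real m" for m
    unfolding log_coeff_def poly_sum sum_divide_distrib
    by (rule sum.cong[OF refl]) (simp add: f_eq poly_monom)
  have fib_abs: "(\<Sum>p\<in>prime_powers m. \<bar>f p\<bar>) \<le> 8 / q * (19/20) ^ m" for m
  proof (cases "m = 0")
    case True
    have "p \<notin> prime_powers 0" for p using prime_powers_bounds(5)[of "fst p" "snd p" 0] by auto
    then have "prime_powers 0 = {}" by blast
    then show ?thesis using True q0 by simp
  next
    case False
    have "(\<Sum>p\<in>prime_powers m. \<bar>f p\<bar>) = (\<Sum>p\<in>prime_powers m. real (degree (fst p)) / q ^ m * \<bar>x ^ snd p - x\<bar>) / real m"
      unfolding sum_divide_distrib using q0 by (intro sum.cong refl) (simp add: f_eq abs_mult)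
    also have "\<dots> \<le> (8 / q * real m * (19/20) ^ m) / real m"
    proof (intro divide_right_mono sum_prime_powers_le)
      fix j :: nat assume "j \<ge> 2"
      have "x ^ j \<le> (9/5) ^ j" using x by (intro power_mono) simp_all
      moreover have "x \<le> (9/5) ^ j" using x power_increasing[of 1 j "9/5::real"] \<open>j \<ge> 2\<close> by simp
      moreover have "x ^ j \<ge> 0" using x by simp
      ultimately show "\<bar>x ^ j - x\<bar> \<le> 2 * (9/5) ^ j" using x by linarith
    qed simp_all
    finally show ?thesis using False by simp
  qed
  have "(\<lambda>z. \<bar>f (snd z)\<bar>) summable_on W"
    unfolding W_def
  proof (rule summable_on_SigmaI)
    show "((\<lambda>p. \<bar>f (snd (m, p))\<bar>) has_sum (\<Sum>p\<in>prime_powers m. \<bar>f p\<bar>)) (prime_powers m)" for m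
      using has_sum_finite[OF finite_prime_powers, of "\<lambda>p. \<bar>f p\<bar>"] by simp
    have "summable (\<lambda>m. 8 / q * (19/20) ^ m)" by (intro summable_mult summable_geometric) simp
    then have "summable (\<lambda>m. norm (\<Sum>p\<in>prime_powers m. \<bar>f p\<bar>))"
      by (rule summable_comparison_test'[of _ 0]) (use fib_abs in simp)
    then show "(\<lambda>m. \<Sum>p\<in>prime_powers m. \<bar>f p\<bar>) summable_on UNIV"
      by (rule norm_summable_imp_summable_on)
  qed simp
  then have "(\<lambda>z. f (snd z)) summable_on W"
    using abs_summable_summable[of "\<lambda>z. f (snd z)" W] by (simp only: real_norm_def)
  then obtain S where S: "((\<lambda>z. f (snd z)) has_sum S) W" by (auto simp: summable_on_def)
  have "((\<lambda>m. \<Sum>p\<in>prime_powers m. f p) has_sum S) UNIV"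
  proof (rule has_sum_SigmaD[OF S[unfolded W_def]])
    show "((\<lambda>p. f (snd (m, p))) has_sum (\<Sum>p\<in>prime_powers m. f p)) (prime_powers m)" for m
      using has_sum_finite[OF finite_prime_powers, of f] by simp
  qed
  then have S_eq: "(\<Sum>m. poly (log_coeff m) x / real m) = S"
    unfolding fib by (intro sums_unique[symmetric] has_sum_imp_sums)
  \<comment> \<open>The tag m is determined by the pair (P, j), so \<open>W\<close> is the set of
    all pairs arranged by degree.\<close>
  have bij: "bij_betw snd W (MI \<times> {1::nat..})"
  proof (rule bij_betw_imageI)
    show "inj_on snd W"
    proof (rule inj_onI)
      have W: "fst y = snd (snd y) * degree (fst (snd y))" if "y \<in> W" for y
      proof -
        have "snd y \<in> prime_powers (fst y)"
          using that unfolding W_def by (cases y) (simp only: mem_Sigma_iff fst_conv snd_conv)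
        then show ?thesis unfolding prime_powers_def mem_Collect_eq case_prod_unfold by simp
      qed
      fix y z assume yz: "y \<in> W" "z \<in> W" and eq: "snd y = snd z"
      have "fst y = fst z" unfolding W[OF yz(1)] W[OF yz(2)] eq ..
      with eq show "y = z" by (simp only: prod_eq_iff)
    qed
    show "snd ` W = MI \<times> {1::nat..}"
    proof (intro Set.set_eqI iffI)
      fix p assume "p \<in> snd ` W"
      then obtain m where "p \<in> prime_powers m" unfolding W_def by force
      then show "p \<in> MI \<times> {1::nat..}" unfolding prime_powers_def by blast
    next
      fix p assume p: "p \<in> MI \<times> {1::nat..}"
      have "p \<in> prime_powers (snd p * degree (fst p))"
        using p unfolding prime_powers_def by (simp only: mem_Collect_eq case_prod_unfold mem_Times_iff atLeast_iff)
      then have "(snd p * degree (fst p), p) \<in> W" unfolding W_def by blast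
      then show "p \<in> snd ` W" by (rule rev_image_eqI) simp
    qed
  qed
  have "(f has_sum S) (MI \<times> {1::nat..})"
    using has_sum_reindex_bij_betw[OF bij, of f S] S by blast
  then have "((\<lambda>P. ln (inverse (1 - x / poly_norm R P) * (1 - 1 / poly_norm R P) powr x)) has_sum S) MI"
  proof (rule has_sum_SigmaD)
    fix P assume P: "P \<in> MI"
    from poly_norm_ge_2[OF P] show "((\<lambda>j. f (P, j)) has_sum ln (inverse (1 - x / poly_norm R P) * (1 - 1 / poly_norm R P) powr x)) {1..}"
      unfolding f_def fst_conv snd_conv using x by (intro log_euler_factor_has_sum) simp_all
  qed
  then have "((\<lambda>T. exp (\<Sum>P\<in>T. ln (inverse (1 - x / poly_norm R P) * (1 - 1 / poly_norm R P) powr x))) \<longlongrightarrow> exp S)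
      (finite_subsets_at_top MI)"
    unfolding has_sum_def by (rule tendsto_exp)
  moreover have "eventually (\<lambda>T. exp (\<Sum>P\<in>T. ln (inverse (1 - x / poly_norm R P) * (1 - 1 / poly_norm R P) powr x))
     = (\<Prod>P\<in>T. inverse (1 - x / poly_norm R P) * (1 - 1 / poly_norm R P) powr x)) (finite_subsets_at_top MI)"
  proof (rule eventually_finite_subsets_at_top_weakI)
    fix T assume T: "finite T" "T \<subseteq> MI"
    have "exp (ln (inverse (1 - x / poly_norm R P) * (1 - 1 / poly_norm R P) powr x))
      = inverse (1 - x / poly_norm R P) * (1 - 1 / poly_norm R P) powr x" if "P \<in> T" for P
    proof -
      have P: "P \<in> MI" using that T by blast
      from poly_norm_ge_2[OF P] have "0 < 1 - x / poly_norm R P" "1 - 1 / poly_norm R P \<noteq> 0"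
        using x by simp_all
      then have "0 < inverse (1 - x / poly_norm R P) * (1 - 1 / poly_norm R P) powr x"
        by (intro mult_pos_pos positive_imp_inverse_positive) (simp_all only: powr_gt_zero simp_thms)
      then show ?thesis by (rule exp_ln)
    qed
    then show "exp (\<Sum>P\<in>T. ln (inverse (1 - x / poly_norm R P) * (1 - 1 / poly_norm R P) powr x))
     = (\<Prod>P\<in>T. inverse (1 - x / poly_norm R P) * (1 - 1 / poly_norm R P) powr x)"
      using T(1) by (simp add: exp_sum)
  qed
  ultimately have "((\<lambda>T. \<Prod>P\<in>T. inverse (1 - x / poly_norm R P) * (1 - 1 / poly_norm R P) powr x) \<longlongrightarrow> exp S)
      (finite_subsets_at_top MI)"
    by (rule Lim_transform_eventually)
  then show ?thesis unfolding h_def S_eq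
    by (intro tendsto_Lim) simp_all
qed

text \<open>This is H(1, x) = h(x): the coefficient bounds permit evaluating the exponential at u =
  1, and \<open>h_eq_exp\<close> identifies the value.\<close>

lemma suminf_exp_coeffs_log_coeff:
  assumes x: "0 \<le> x" "x \<le> 3/2"
  shows "(\<Sum>m. poly (exp_coeffs log_coeff m) x) = h R x"
proof -
  have q0: "8 / q \<ge> 0" using q_ge_2 by simp
  \<comment> \<open>The radius 101/100 exceeds 1, while 101/100 * 19/20 = 1919/2000 stays below 1.
    Here \<open>M\<close> may depend on q, as only convergence is at stake.\<close>
  define M where "M = Suc (nat \<lceil>8 / q / (1 - 101/100 * (19/20))\<^sup>2\<rceil>)"
  have M: "8 / q / (1 - 101/100 * (19/20))\<^sup>2 \<le> real M" "M \<ge> 1"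
    unfolding M_def by linarith simp
  define B where "B = max (real M ^ M) (8 / q)"
  have le: "\<bar>poly p x\<bar> \<le> wnorm p" for p using x by (intro abs_poly_le_wnorm) simp
  have "(\<Sum>m. poly (exp_coeffs log_coeff m) x) = exp (\<Sum>m. poly (log_coeff m) x / real m)"
  proof (rule suminf_exp_coeffs[where c = "101/100" and B = B])
    fix m
    have "\<bar>poly (exp_coeffs log_coeff m) x\<bar> * (101/100) ^ m \<le> wnorm (exp_coeffs log_coeff m) * (101/100) ^ m"
      by (intro mult_right_mono le) simp
    also have "\<dots> \<le> real M ^ M"
      by (rule exp_coeffs_bound(1)[OF _ _ _ q0 wnorm_log_coeff M]) simp_all
    finally show "\<bar>poly (exp_coeffs log_coeff m) x\<bar> * (101/100) ^ m \<le> B" by (simp add: B_def)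
    show "\<bar>poly (log_coeff m) x / real m\<bar> * (101/100) ^ m \<le> B"
    proof (cases "m = 0")
      case True
      then show ?thesis using q0 by (simp add: B_def le_max_iff_disj)
    next
      case False
      have "\<bar>poly (log_coeff m) x / real m\<bar> \<le> (8 / q * real m * (19/20) ^ m) / real m"
        unfolding abs_divide abs_of_nat by (intro divide_right_mono order.trans[OF le wnorm_log_coeff]) simp
      then have "\<bar>poly (log_coeff m) x / real m\<bar> * (101/100) ^ m \<le> 8 / q * (19/20) ^ m * (101/100) ^ m"
        using False by (intro mult_right_mono) simp_all
      also have "\<dots> = 8 / q * (1919/2000) ^ m" by (simp flip: power_mult_distrib)
      also have "\<dots> \<le> 8 / q * 1" using q0 by (intro mult_left_mono power_le_one) simp_all
      finally show ?thesis by (simp add: B_def)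
    qed
  qed simp
  then show ?thesis using h_eq_exp[OF x] by simp
qed

end

section \<open>The estimate with a constant uniform in the field\<close>

theorem corollary1p1:
  shows "\<exists>(C::real) (N0::real). C > 0 \<and>
    (\<forall>(q::nat) (F::nat ring) (n::nat) (k::nat).
       primepow q \<longrightarrow> field F \<longrightarrow> finite (carrier F) \<longrightarrow> card (carrier F) = q \<longrightarrow>
       n \<ge> 2 \<longrightarrow> real q ^ n \<ge> N0 \<longrightarrow> 1 \<le> k \<longrightarrow> k \<le> n \<longrightarrow>
       (let r = (real k - 1) / ln (real n) in
          r \<le> 3 / 2 \<longrightarrow>
          \<bar>measure_pmf.prob (random_monic F n) {f. Omega F f = k} /
             measure_pmf.prob (random_perm n) {p. num_cycles n p = k} - h F r\<bar>
          \<le> C * real k / (real q * (ln (real n))\<^sup>2)))"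
proof -
  obtain C :: real where C: "C > 0"
    "\<And>(G :: nat \<Rightarrow> real poly) D (n::nat) (k::nat). G 0 = 1 \<Longrightarrow>
      (\<And>m. m \<ge> 1 \<Longrightarrow> wnorm (G m) \<le> D * (100/101) ^ m) \<Longrightarrow>
      n \<ge> 2 \<Longrightarrow> 1 \<le> k \<Longrightarrow> k \<le> n \<Longrightarrow> (real k - 1) / ln (real n) \<le> 3/2 \<Longrightarrow>
      \<bar>(\<Sum>m\<le>n. \<Sum>j\<le>k. Polynomial.coeff (G m) j * cycle_prob (n - m) (k - j)) / cycle_prob n k
         - (\<Sum>m. poly (G m) ((real k - 1) / ln (real n)))\<bar>
      \<le> C * D * (real k / (ln (real n))\<^sup>2)"
    by (rule cycle_ratio_estimate) blast
  \<comment> \<open>The value of (1 - c \<theta>)^2 in \<open>exp_coeffs_bound\<close> for c =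
    101/100 and \<theta> = 19/20.\<close>
  define t :: real where "t = (1 - 101/100 * (19/20))\<^sup>2"
  have t: "t > 0" by (simp add: t_def)
  \<comment> \<open>As q >= 2, the quantity 8 / q / t is at most 4 / t, so \<open>M\<close> and
    \<open>K\<close> can be chosen independently of q.\<close>
  define M where "M = Suc (nat \<lceil>4 / t\<rceil>)"
  define K where "K = 8 / t * real M ^ M"
  have "real M > 0" unfolding M_def by (rule of_nat_0_less_iff[THEN iffD2]) simp
  then have K: "K > 0" using t by (simp add: K_def)
  show ?thesis
  proof (intro exI[of _ "C * K"] exI[of _ "0 :: real"] conjI allI impI)
    show "C * K > 0" using C(1) K by simp
  next
    fix q :: nat and F :: "nat ring" and n k :: nat
    assume F: "field F" "finite (carrier F)" and q: "card (carrier F) = q"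
      and n: "n \<ge> 2" and k: "1 \<le> k" "k \<le> n"
    interpret finite_nat_field F
      using F by (simp add: finite_nat_field_def finite_nat_field_axioms_def)
    have q2: "real q \<ge> 2" using q_ge_2 q by simp
    have "8 / real q / t \<le> 4 / t" using q2 t by (intro divide_right_mono) (simp_all add: field_simps)
    then have M: "8 / real q / (1 - 101/100 * (19/20))\<^sup>2 \<le> real M" "M \<ge> 1"
      unfolding M_def t_def by linarith simp
    \<comment> \<open>The second part of \<open>exp_coeffs_bound\<close> allows D = K / q in
      \<open>cycle_ratio_estimate\<close>, which is the source of the factor 1/q.\<close>
    have bound: "wnorm (exp_coeffs log_coeff m) \<le> K / real q * (100/101) ^ m" if "m \<ge> 1" for m
    proof -
      have "wnorm (exp_coeffs log_coeff m) * (101/100) ^ m \<le> 8 / real q / t * real M ^ M"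
        unfolding t_def using wnorm_log_coeff[unfolded q]
        by (intro exp_coeffs_bound(2)[OF _ _ _ _ _ M that]) simp_all
      then have "wnorm (exp_coeffs log_coeff m) * (101/100) ^ m * (100/101) ^ m
        \<le> 8 / real q / t * real M ^ M * (100/101) ^ m" by (intro mult_right_mono) simp_all
      moreover have "(101/100::real) ^ m * (100/101) ^ m = 1" by (simp flip: power_mult_distrib)
      ultimately show ?thesis by (simp add: K_def mult_ac)
    qed
    show "let r = (real k - 1) / ln (real n) in
          r \<le> 3 / 2 \<longrightarrow>
          \<bar>measure_pmf.prob (random_monic F n) {f. Omega F f = k} /
             measure_pmf.prob (random_perm n) {p. num_cycles n p = k} - h F r\<bar>
          \<le> C * K * real k / (real q * (ln (real n))\<^sup>2)"
      unfolding Let_def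
    proof
      assume r: "(real k - 1) / ln (real n) \<le> 3 / 2"
      have r0: "0 \<le> (real k - 1) / ln (real n)" using n k by simp
      show "\<bar>measure_pmf.prob (random_monic F n) {f. Omega F f = k} /
             measure_pmf.prob (random_perm n) {p. num_cycles n p = k} - h F ((real k - 1) / ln (real n))\<bar>
          \<le> C * K * real k / (real q * (ln (real n))\<^sup>2)"
        using C(2)[of "exp_coeffs log_coeff", OF _ bound n k r]
        unfolding prob_Omega prob_num_cycles suminf_exp_coeffs_log_coeff[OF r0 r] by simp
    qed
  qed
qed

end
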